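(* There exist a set $\Theta\subset\mathbb{S}^1$ with $\dim_{\mathrm{qA}}\Theta\le\tfrac13$, and two sequences of positive numbers $\{\delta_n\}_{n\in\mathbb{N}}\subset(0,1)$ and $\{\epsilon_n\}_{n\in\mathbb{N}}$, both converging to $0$, such that $$\|\mathcal{N}_{\Theta;\delta_n}\|_{L^q(\mathbb{R}^2)\to L^q(\mathbb{R}^2)}\ge\delta_n^{\frac23-\frac1q+\epsilon_n},\qquad n\in\mathbb{N},\ q\in[1,\infty).$$
   Context: A $\delta$-tube in $\mathbb{R}^2$ is the closed $(\delta/2)$-neighbourhood of a unit line segment; its centre $x(T)$ is the midpoint of the segment and its direction $\omega(T)\in\mathbb{S}^1$ is the direction of the segment. For $\Theta\subseteq\mathbb{S}^1$ and $\delta\in(0,1)$, the Nikodým maximal operator restricted to $\Theta$ is $$\mathcal{N}_{\Theta;\delta}f(x):=\sup_{x(T)=x,\ \omega(T)\in\Theta}\frac{1}{\mathrm{Leb}(T)}\int_T|f(y)|\,dy,\qquad f\in L^1_{\mathrm{loc}}(\mathbb{R}^2),$$ the supremum being over all $\delta$-tubes $T$ with centre $x$ and direction in $\Theta$. Quasi-Assouad dimension: for a bounded set $A\subset\mathbb{R}^d$ and $r>0$, let $|A|_r$ be the minimal number of closed $r$-balls needed to cover $A$. For non-empty $E\subseteq\mathbb{R}^d$ and $\gamma\in(0,1)$ let $$h_E(\gamma):=\inf\{\alpha:\ \exists C>0\text{ such that for all }0<r<r^{1-\gamma}<R\text{ and }x\in E,\ |B(x,R)\cap E|_r\le C(R/r)^\alpha\},$$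 and $\dim_{\mathrm{qA}}E:=\lim_{\gamma\to0^+}h_E(\gamma)$; also $\dim_{\mathrm{qA}}\varnothing:=0$. *)

theory Defs
  imports "HOL-Analysis.Analysis"
begin

section \<open>Quasi-Assouad dimension\<close>

(* Centres of the covering balls may lie anywhere in the ambient space.
   The value is meaningful for bounded A and r > 0. *)
definition covering_number :: "'a::euclidean_space set \<Rightarrow> real \<Rightarrow> nat" where
  "covering_number A r =
     (LEAST n. \<exists>K. finite K \<and> card K = n \<and> A \<subseteq> (\<Union>z\<in>K. cball z r))"

(* For non-empty E the set of exponents contains no negative number (let R tend to infinity)
   and contains the dimension of the ambient space, so the real infimum is the genuine one. *)
definition qA_h :: "'a::euclidean_space set \<Rightarrow> real \<Rightarrow> real" where
  "qA_h E \<gamma> =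
     Inf {\<alpha>. \<exists>C>0. \<forall>r R. \<forall>x\<in>E.
            0 < r \<and> r < r powr (1 - \<gamma>) \<and> r powr (1 - \<gamma>) < R \<longrightarrow>
            real (covering_number (cball x R \<inter> E) r) \<le> C * (R / r) powr \<alpha>}"

(* qA_h E is non-increasing and bounded on (0,1) for non-empty E, so the limit exists. *)
definition qA_dim :: "'a::euclidean_space set \<Rightarrow> real" where
  "qA_dim E = (if E = {} then 0 else Lim (at_right 0) (qA_h E))"

section \<open>Nikodym maximal operator\<close>

(* Used for unit vectors w: the tube of width d around the unit segment with midpoint x
   and direction w. *)
definition tube :: "real \<Rightarrow> real ^ 2 \<Rightarrow> real ^ 2 \<Rightarrow> (real ^ 2) set" where
  "tube d x w =
     {y. infdist y (closed_segment (x - (1/2) *\<^sub>R w) (x + (1/2) *\<^sub>R w)) \<le> d / 2}"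

definition nikodym ::
    "(real ^ 2) set \<Rightarrow> real \<Rightarrow> (real ^ 2 \<Rightarrow> real) \<Rightarrow> real ^ 2 \<Rightarrow> ennreal" where
  "nikodym \<Theta> d f x =
     (SUP w\<in>\<Theta>. (\<integral>\<^sup>+y\<in>tube d x w. ennreal \<bar>f y\<bar> \<partial>lebesgue) / emeasure lebesgue (tube d x w))"

section \<open>Operator norms on Lebesgue spaces\<close>

(* Only used with exponent p > 0. *)
definition ennreal_powr :: "ennreal \<Rightarrow> real \<Rightarrow> ennreal" where
  "ennreal_powr a p = (if a = \<infinity> then \<infinity> else ennreal (enn2real a powr p))"

definition Lq_norm :: "real \<Rightarrow> (real ^ 2 \<Rightarrow> ennreal) \<Rightarrow> ennreal" where
  "Lq_norm q g = ennreal_powr (\<integral>\<^sup>+x. ennreal_powr (g x) q \<partial>lebesgue) (1 / q)"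

(* The operators considered are positively homogeneous but not linear and take values in
   [0,\<infinity>]; the norm is the supremum over the unit ball of L^q. *)
definition Lq_op_norm ::
    "real \<Rightarrow> ((real ^ 2 \<Rightarrow> real) \<Rightarrow> real ^ 2 \<Rightarrow> ennreal) \<Rightarrow> ennreal" where
  "Lq_op_norm q N =
     (SUP f \<in> {f \<in> borel_measurable lebesgue. Lq_norm q (\<lambda>x. ennreal \<bar>f x\<bar>) \<le> 1}.
        Lq_norm q (N f))"

end

theory Submission
  imports Defs
begin

text \<open>The exponent \<open>2/3 - 1/q\<close> comes from the sharp example for the Szemeredi-Trotter theorem. In a
  grid of \<open>N powr (1/3)\<close> abscissae and \<open>N powr (2/3)\<close> ordinates, \<open>N\<close> lines with \<open>N powr (1/3)\<close> slopes have
  \<open>N powr (1/3)\<close> grid points each. Thicken everything by \<open>\<delta> = 1/N\<close> and let \<open>E\<close> be the union of the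
  \<open>\<delta>\<close>-squares at the grid points. Then \<open>E\<close> has area about \<open>\<delta>\<close>, the tubes fill a set of area about \<open>1\<close>, and \<open>E\<close> has
  density about \<open>\<delta> powr (2/3)\<close> in each of them. The indicator of \<open>E\<close> yields the bound for all \<open>q\<close>
  simultaneously.

  If the slopes are an arithmetic progression, they are far too dense at scales above
  \<open>\<delta> powr (1/3)\<close>. So the example is iterated \<open>K\<close> times with a large base \<open>A\<close>, with \<open>\<delta>\<close> about \<open>A ^ (-3 K)\<close>:
  the base-\<open>A\<close> digits of the slopes occupy every third place, which makes a Cantor set of dimension \<open>1/3\<close>,
  and the places of the abscissae are such that the ordinates \<open>\<theta> * x + b\<close> only use the remaining two thirds.
  Products of digit sums are convolutions, so the structure survives multiplication up to a factor
  \<open>(6 K) ^ K\<close> in the number of ordinates (lemma \<open>product_digits\<close>). That the tubes fill a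
  rectangle follows from a greedy expansion of the second coordinate, with the first coordinate as a parameter
  (lemma \<open>greedy_expansion\<close>). Together they give the norm bound at one scale,
  lemma \<open>nikodym_op_norm_cantor\<close>.

  One set of directions has to serve infinitely many scales. For this the Cantor sets with
  parameters \<open>A n\<close> and \<open>K n\<close> are dilated towards slope \<open>0\<close> by factors \<open>\<eta> n = A n ^ (- Suc n)\<close> and united. At
  scale \<open>r\<close> all pieces with \<open>\<eta> n\<close> well below \<open>r\<close> are invisible. For the others the losses of the
  construction are subpolynomial in \<open>1/r\<close>, and the quasi-Assouad dimension ignores such losses since it compares
  only scales with \<open>R/r > (1/r) powr \<gamma>\<close> (lemma \<open>qA_dim_union_slopes\<close>). On the other hand, \<open>\<eta> n\<close> is a
  power of the mesh with exponent about \<open>1 / (3 * Suc n)\<close>, so the dilation costs no more than \<open>\<epsilon> n\<close> in the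
  exponent (lemma \<open>scale_exponent_bound\<close>).\<close>

section \<open>Covering numbers and quasi-Assouad dimension\<close>

lemma covering_number_le:
  assumes "finite K" "A \<subseteq> (\<Union>z\<in>K. cball z r)"
  shows "covering_number A r \<le> card K"
  unfolding covering_number_def by (rule Least_le) (use assms in blast)

text \<open>Without boundedness no finite family of balls need exist, and the \<open>LEAST\<close> in the definition
  would be an arbitrary number.\<close>
lemma covering_number_ge_1:
  fixes A :: "'a::euclidean_space set"
  assumes "x \<in> A" "bounded A" "r > 0"
  shows "covering_number A r \<ge> 1"
proof -
  have "compact (closure A)" using assms(2) by simp
  moreover have "closure A \<subseteq> (\<Union>z\<in>closure A. ball z r)" using assms(3) by auto
  ultimately obtain K where "K \<subseteq> closure A" and K: "finite K" "closure A \<subseteq> (\<Union>z\<in>K. ball z r)"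
    by (rule compactE_image[OF _ open_ball])
  have "A \<subseteq> (\<Union>z\<in>K. cball z r)"
  proof
    fix y assume "y \<in> A"
    then have "y \<in> (\<Union>z\<in>K. ball z r)" using closure_subset K(2) by blast
    then show "y \<in> (\<Union>z\<in>K. cball z r)" by fastforce
  qed
  with K(1) have "\<exists>n K. finite K \<and> card K = n \<and> A \<subseteq> (\<Union>z\<in>K. cball z r)" by blast
  from LeastI_ex[OF this] obtain K' where
    "finite K'" "card K' = covering_number A r" "A \<subseteq> (\<Union>z\<in>K'. cball z r)"
    unfolding covering_number_def by blast
  then show ?thesis using assms(1) by (cases "K' = {}") (auto simp: Suc_le_eq card_gt_0_iff)
qed

text \<open>The admissible exponents are named because monotonicity in \<open>\<gamma>\<close>, a lower bound
  and an explicit upper bound for their infimum are separate matters.\<close>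
definition qA_exponents :: "'a::euclidean_space set \<Rightarrow> real \<Rightarrow> real set" where
  "qA_exponents E \<gamma> = {\<alpha>. \<exists>C>0. \<forall>r R. \<forall>x\<in>E.
     0 < r \<and> r < r powr (1 - \<gamma>) \<and> r powr (1 - \<gamma>) < R \<longrightarrow>
     real (covering_number (cball x R \<inter> E) r) \<le> C * (R / r) powr \<alpha>}"

text \<open>For a fixed radius \<open>r\<close> the covering number stays at least \<open>1\<close> as \<open>R\<close> grows,
  whereas \<open>(R/r) powr \<alpha>\<close> tends to \<open>0\<close> for negative \<open>\<alpha>\<close>. So the real infimum below is
  taken over a set that is bounded below.\<close>
lemma qA_exponents_nonneg:
  assumes "E \<noteq> {}" "\<gamma> > 0" "\<alpha> \<in> qA_exponents E \<gamma>"
  shows "\<alpha> \<ge> 0"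
proof (rule ccontr)
  assume neg: "\<not> \<alpha> \<ge> 0"
  obtain x where x: "x \<in> E" using assms(1) by blast
  obtain C where C: "C > 0" "\<And>r R. 0 < r \<Longrightarrow> r < r powr (1 - \<gamma>) \<Longrightarrow> r powr (1 - \<gamma>) < R \<Longrightarrow>
     real (covering_number (cball x R \<inter> E) r) \<le> C * (R / r) powr \<alpha>"
    using assms(3) x unfolding qA_exponents_def by blast
  have half: "(1/2::real) < (1/2) powr (1 - \<gamma>)"
    using powr_less_mono'[of "1/2::real" "1-\<gamma>" 1] assms(2) by simp
  have "filterlim (\<lambda>R::real. R / (1/2)) at_top at_top"
    using filterlim_tendsto_pos_mult_at_top[OF tendsto_const, of "2::real" "\<lambda>R. R" at_top]
    by (simp add: filterlim_ident mult.commute)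
  then have "((\<lambda>R::real. C * (R / (1/2)) powr \<alpha>) \<longlongrightarrow> C * 0) at_top"
    using neg by (intro tendsto_intros tendsto_neg_powr) auto
  then have "eventually (\<lambda>R::real. C * (R / (1/2)) powr \<alpha> < 1) at_top"
    by (simp add: order_tendsto_iff)
  then have "eventually (\<lambda>R::real. C * (R / (1/2)) powr \<alpha> < 1 \<and> (1/2) powr (1 - \<gamma>) < R \<and> 0 < R) at_top"
    by (intro eventually_conj eventually_gt_at_top)
  then obtain R where R: "C * (R / (1/2)) powr \<alpha> < 1" "(1/2) powr (1 - \<gamma>) < R" "0 < R"
    using eventually_happens by force
  have "covering_number (cball x R \<inter> E) (1/2) \<ge> 1"
    by (rule covering_number_ge_1[of x]) (use x R in \<open>auto intro: bounded_subset[OF bounded_cball]\<close>)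
  then show False using C(2)[of "1/2" R] half R by simp
qed

text \<open>The condition \<open>r < r powr (1 - \<gamma>)\<close> forces \<open>r < 1\<close>, so a larger \<open>\<gamma>\<close> asks for a larger
  separation of the two scales and hence tests fewer pairs of radii.\<close>
lemma qA_exponents_mono:
  assumes "0 < \<gamma>" "\<gamma> \<le> \<gamma>'"
  shows "qA_exponents E \<gamma> \<subseteq> qA_exponents E \<gamma>'"
proof
  fix \<alpha> assume "\<alpha> \<in> qA_exponents E \<gamma>"
  then obtain C where C: "C > 0" "\<And>r R x. x \<in> E \<Longrightarrow> 0 < r \<Longrightarrow> r < r powr (1 - \<gamma>) \<Longrightarrow> r powr (1 - \<gamma>) < R \<Longrightarrow>
     real (covering_number (cball x R \<inter> E) r) \<le> C * (R / r) powr \<alpha>"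
    unfolding qA_exponents_def by blast
  have "real (covering_number (cball x R \<inter> E) r) \<le> C * (R / r) powr \<alpha>"
    if "x \<in> E" "0 < r" "r < r powr (1 - \<gamma>')" "r powr (1 - \<gamma>') < R" for x r R
  proof -
    have "r < 1"
    proof (rule ccontr)
      assume "\<not> r < 1"
      then have "r powr (1 - \<gamma>') \<le> r powr 1" using assms by (intro powr_mono) auto
      then show False using that by simp
    qed
    then have "r < r powr (1 - \<gamma>)" "r powr (1 - \<gamma>) \<le> r powr (1 - \<gamma>')"
      using powr_less_mono'[of r "1-\<gamma>" 1] powr_mono'[of "1-\<gamma>'" "1-\<gamma>" r] that assms by auto
    then show ?thesis using C(2)[of x r R] that by linarith
  qed
  then show "\<alpha> \<in> qA_exponents E \<gamma>'" using C(1) unfolding qA_exponents_def by blast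
qed

text \<open>By monotonicity the limit as \<open>\<gamma>\<close> tends to \<open>0\<close> exists and is the supremum over all \<open>\<gamma>\<close>, so
  it suffices to bound each term of the supremum.\<close>
lemma qA_dim_le:
  assumes "E \<noteq> {}" and mem: "\<And>\<gamma> \<alpha>. 0 < \<gamma> \<Longrightarrow> \<alpha> > a \<Longrightarrow> \<alpha> \<in> qA_exponents E \<gamma>"
  shows "qA_dim E \<le> a"
proof -
  have h: "qA_h E \<gamma> = Inf (qA_exponents E \<gamma>)" for \<gamma>
    by (simp add: qA_h_def qA_exponents_def)
  have bdd: "bdd_below (qA_exponents E \<gamma>)" if "\<gamma> > 0" for \<gamma>
    using qA_exponents_nonneg[OF assms(1) that] by (meson bdd_below.I)
  have le: "qA_h E \<gamma> \<le> a" if "\<gamma> > 0" for \<gamma>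
    unfolding h by (rule dense_ge) (use mem bdd that in \<open>auto intro: cInf_lower\<close>)
  have anti: "qA_h E \<gamma>' \<le> qA_h E \<gamma>" if "0 < \<gamma>" "\<gamma> \<le> \<gamma>'" for \<gamma> \<gamma>'
    unfolding h using that mem[of \<gamma> "a+1"] bdd[of \<gamma>'] qA_exponents_mono[OF that, of E]
    by (intro cInf_superset_mono) auto
  define s where "s = (SUP \<gamma>\<in>{0<..}. qA_h E \<gamma>)"
  have bs: "bdd_above (qA_h E ` {0<..})" using le by (auto intro!: bdd_aboveI[of _ a])
  have "(qA_h E \<longlongrightarrow> s) (at_right 0)"
  proof (rule order_tendstoI)
    fix c assume "c < s"
    then obtain \<gamma>0 where g: "\<gamma>0 > 0" "c < qA_h E \<gamma>0"
      unfolding s_def using less_cSUP_iff[OF _ bs] by auto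
    have "\<forall>\<^sub>F \<gamma> in at_right 0. \<gamma> \<in> {0<..<\<gamma>0}"
      using eventually_at_right_real[OF g(1)] .
    then show "\<forall>\<^sub>F \<gamma> in at_right 0. c < qA_h E \<gamma>"
      by eventually_elim (use g anti[of _ \<gamma>0] in force)
  next
    fix c assume c: "s < c"
    have "qA_h E \<gamma> < c" if "\<gamma> > 0" for \<gamma>
      using cSUP_upper[OF _ bs, of \<gamma>] that c unfolding s_def by auto
    then show "\<forall>\<^sub>F \<gamma> in at_right 0. qA_h E \<gamma> < c"
      by (auto simp: eventually_at_right_less intro: eventually_mono[OF eventually_at_right_less])
  qed
  then have "Lim (at_right 0) (qA_h E) = s"
    by (intro tendsto_Lim) auto
  moreover have "s \<le> a" unfolding s_def using le by (intro cSUP_least) (auto intro: exI[of _ 1])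
  ultimately show ?thesis using assms(1) by (simp add: qA_dim_def)
qed


section \<open>Lower bounds for the operator norm\<close>

lemma ennreal_powr_ennreal: "0 \<le> a \<Longrightarrow> ennreal_powr (ennreal a) p = ennreal (a powr p)"
  by (simp add: ennreal_powr_def)

lemma ennreal_powr_mono:
  assumes "a \<le> b" "0 \<le> p"
  shows "ennreal_powr a p \<le> ennreal_powr b p"
proof (cases b)
  case (real b')
  then obtain a' where "a = ennreal a'" "0 \<le> a'" "a' \<le> b'"
    using assms(1) by (metis ennreal_cases ennreal_le_iff ennreal_less_top leD top.extremum_unique ennreal_neq_top)
  then show ?thesis using real assms(2) by (auto simp: ennreal_powr_ennreal intro!: ennreal_leI powr_mono2)
qed (auto simp: ennreal_powr_def)

lemma Lq_norm_mult_indicator: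
  assumes "0 < q" "0 \<le> c" "S \<in> sets lebesgue" "emeasure lebesgue S = ennreal m" "0 \<le> m"
  shows "Lq_norm q (\<lambda>x. ennreal (c * indicator S x)) = ennreal (c * m powr (1/q))"
proof -
  have "(\<integral>\<^sup>+x. ennreal_powr (ennreal (c * indicator S x)) q \<partial>lebesgue)
      = (\<integral>\<^sup>+x. ennreal (c powr q) * indicator S x \<partial>lebesgue)"
    using assms by (intro nn_integral_cong)
      (auto simp: indicator_def ennreal_powr_ennreal ennreal_powr_def)
  also have "\<dots> = ennreal (c powr q * m)"
    using assms by (simp add: nn_integral_cmult_indicator ennreal_mult)
  finally show ?thesis
    using assms by (simp add: Lq_norm_def ennreal_powr_ennreal powr_mult powr_powr)
qed

lemma Lq_norm_mono:
  assumes "0 < q" "\<And>x. g x \<le> h x"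
  shows "Lq_norm q g \<le> Lq_norm q h"
  unfolding Lq_norm_def using assms by (intro ennreal_powr_mono nn_integral_mono) auto

lemma closed_tube: "closed (tube d x w)"
  unfolding tube_def
  by (intro closed_Collect_le continuous_intros) (auto simp: continuous_on_infdist)

lemma inverse_ennreal_antimono: "(a::ennreal) \<le> b \<Longrightarrow> inverse b \<le> inverse a"
  by (cases "a = 0"; cases a; cases b)
    (auto simp: inverse_ennreal ennreal_eq_0_iff top_unique intro!: ennreal_leI le_imp_inverse_le)

lemma nikodym_ge:
  assumes "w \<in> \<Theta>" "E \<in> sets lebesgue" "0 \<le> c" "0 \<le> \<mu>" "0 < \<nu>"
    and "ennreal \<mu> \<le> emeasure lebesgue (E \<inter> tube d x w)"
    and "emeasure lebesgue (tube d x w) \<le> ennreal \<nu>"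
  shows "ennreal (c * (\<mu> / \<nu>)) \<le> nikodym \<Theta> d (\<lambda>y. c * indicator E y) x"
proof -
  let ?T = "tube d x w"
  have T: "?T \<in> sets lebesgue" using closed_tube by (metis borel_closed sets_completionI_sets sets_lborel)
  have "(\<integral>\<^sup>+y\<in>?T. ennreal \<bar>c * indicator E y\<bar> \<partial>lebesgue)
      = (\<integral>\<^sup>+y. ennreal c * indicator (E \<inter> ?T) y \<partial>lebesgue)"
    using assms by (intro nn_integral_cong) (auto simp: indicator_def)
  also have "\<dots> = ennreal c * emeasure lebesgue (E \<inter> ?T)"
    using assms T by (simp add: nn_integral_cmult_indicator)
  also have "\<dots> \<ge> ennreal c * ennreal \<mu>" using assms by (intro mult_left_mono) auto
  finally have I: "ennreal c * ennreal \<mu> \<le> (\<integral>\<^sup>+y\<in>?T. ennreal \<bar>c * indicator E y\<bar> \<partial>lebesgue)" .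
  have "ennreal (c * (\<mu> / \<nu>)) = ennreal c * ennreal \<mu> / ennreal \<nu>"
    using assms by (simp add: divide_ennreal flip: ennreal_mult)
  also have "\<dots> \<le> (\<integral>\<^sup>+y\<in>?T. ennreal \<bar>c * indicator E y\<bar> \<partial>lebesgue) / emeasure lebesgue ?T"
    using I assms(7) unfolding divide_ennreal_def by (intro mult_mono inverse_ennreal_antimono) auto
  also have "\<dots> \<le> nikodym \<Theta> d (\<lambda>y. c * indicator E y) x"
    unfolding nikodym_def by (rule SUP_upper[OF assms(1)])
  finally show ?thesis .
qed

text \<open>Testing on the indicator of \<open>E\<close>, normalised in \<open>L\<^sup>q\<close>: if every point of \<open>F\<close> is
  the centre of an admissible tube in which \<open>E\<close> has density at least \<open>\<mu> / \<nu>\<close>, then the maximal function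
  of the indicator is at least \<open>\<mu> / \<nu>\<close> on \<open>F\<close>. The same pair of sets serves all exponents \<open>q\<close>
  at once.\<close>
lemma nikodym_op_norm_ge:
  assumes "1 \<le> q" "E \<in> sets lebesgue" "F \<in> sets lebesgue"
    and E: "emeasure lebesgue E \<le> ennreal M" "0 < M"
    and F: "emeasure lebesgue F = ennreal m" "0 \<le> m"
    and "0 \<le> \<mu>" "0 < \<nu>"
    and ex: "\<And>x. x \<in> F \<Longrightarrow> \<exists>w\<in>\<Theta>. ennreal \<mu> \<le> emeasure lebesgue (E \<inter> tube d x w) \<and>
                              emeasure lebesgue (tube d x w) \<le> ennreal \<nu>"
  shows "ennreal (\<mu> / \<nu> * (m / M) powr (1/q)) \<le> Lq_op_norm q (nikodym \<Theta> d)"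
proof -
  define c where "c = M powr (-1/q)"
  have c: "c \<ge> 0" by (simp add: c_def)
  define f where "f = (\<lambda>y::real^2. c * indicator E y)"
  obtain e where e: "emeasure lebesgue E = ennreal e" "0 \<le> e" "e \<le> M"
    using E by (metis ennreal_cases ennreal_le_iff ennreal_less_top leD top.extremum_unique ennreal_neq_top less_imp_le)
  have "Lq_norm q (\<lambda>x. ennreal \<bar>f x\<bar>) = ennreal (c * e powr (1/q))"
    using Lq_norm_mult_indicator[of q c E e] assms e c by (simp add: f_def abs_mult)
  moreover have "c * e powr (1/q) \<le> 1"
  proof -
    have "c * e powr (1/q) \<le> M powr (-1/q) * M powr (1/q)"
    unfolding c_def using e assms by (intro mult_left_mono powr_mono2) auto
    also have "\<dots> = 1" using \<open>0 < M\<close> by (simp flip: powr_add)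
    finally show ?thesis .
  qed
  ultimately have "Lq_norm q (\<lambda>x. ennreal \<bar>f x\<bar>) \<le> 1"
    using ennreal_leI[of _ 1] by simp
  moreover have "f \<in> borel_measurable lebesgue" unfolding f_def using assms(2) by measurable
  ultimately have "Lq_norm q (nikodym \<Theta> d f) \<le> Lq_op_norm q (nikodym \<Theta> d)"
    unfolding Lq_op_norm_def by (intro SUP_upper) auto
  moreover have "Lq_norm q (\<lambda>x. ennreal ((c * (\<mu> / \<nu>)) * indicator F x)) \<le> Lq_norm q (nikodym \<Theta> d f)"
  proof (rule Lq_norm_mono)
    fix x show "ennreal (c * (\<mu> / \<nu>) * indicator F x) \<le> nikodym \<Theta> d f x"
      using ex[of x] nikodym_ge[of _ \<Theta> E c \<mu> \<nu> d x] assms c unfolding f_def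
      by (cases "x \<in> F") auto
  qed (use assms in auto)
  moreover have "Lq_norm q (\<lambda>x. ennreal ((c * (\<mu> / \<nu>)) * indicator F x)) = ennreal (c * (\<mu> / \<nu>) * m powr (1/q))"
    using assms c by (intro Lq_norm_mult_indicator) auto
  moreover have "c * (\<mu> / \<nu>) * m powr (1/q) = \<mu> / \<nu> * (m / M) powr (1/q)"
    using F(2) E(2) by (simp add: c_def powr_divide powr_minus_divide)
  ultimately show ?thesis by (metis order_trans)
qed


section \<open>Slopes, squares and tubes\<close>

lemma emeasure_cbox_2:
  fixes a b c d :: real
  assumes "a \<le> b" "c \<le> d"
  shows "emeasure lebesgue {p::real^2. a \<le> p$1 \<and> p$1 \<le> b \<and> c \<le> p$2 \<and> p$2 \<le> d} = ennreal ((b-a)*(d-c))"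
    "{p::real^2. a \<le> p$1 \<and> p$1 \<le> b \<and> c \<le> p$2 \<and> p$2 \<le> d} \<in> sets lebesgue"
proof -
  have eq: "{p::real^2. a \<le> p$1 \<and> p$1 \<le> b \<and> c \<le> p$2 \<and> p$2 \<le> d} = cbox (vector [a,c]) (vector [b,d])"
    by (auto simp: mem_box_cart forall_2)
  have ne: "cbox (vector [a,c]) (vector [b,d]) \<noteq> ({}::(real^2) set)"
    using assms by (simp add: interval_ne_empty_cart forall_2)
  have "measure lborel (cbox (vector [a,c]) (vector [b,d]) :: (real^2) set) = (b-a)*(d-c)"
    using content_cbox_cart[OF ne] by (simp add: UNIV_2)
  moreover have "emeasure lebesgue (cbox (vector [a,c]) (vector [b,d]) :: (real^2) set) =
    ennreal (measure lborel (cbox (vector [a,c]) (vector [b,d]) :: (real^2) set))"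
    using emeasure_eq_ennreal_measure[of lebesgue "cbox (vector [a,c]) (vector [b,d]) :: (real^2) set"]
    by (simp add: emeasure_lborel_cbox_eq)
  ultimately show "emeasure lebesgue {p::real^2. a \<le> p$1 \<and> p$1 \<le> b \<and> c \<le> p$2 \<and> p$2 \<le> d} = ennreal ((b-a)*(d-c))"
    by (simp add: eq)
  show "{p::real^2. a \<le> p$1 \<and> p$1 \<le> b \<and> c \<le> p$2 \<and> p$2 \<le> d} \<in> sets lebesgue"
    unfolding eq by simp
qed

definition square :: "real \<Rightarrow> real \<Rightarrow> real \<Rightarrow> (real^2) set" where
  "square \<rho> x y = {p. x \<le> p$1 \<and> p$1 \<le> x + \<rho> \<and> y \<le> p$2 \<and> p$2 \<le> y + \<rho>}"

lemma square_lebesgue: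
  assumes "0 \<le> \<rho>"
  shows "square \<rho> x y \<in> sets lebesgue" "emeasure lebesgue (square \<rho> x y) = ennreal (\<rho>\<^sup>2)"
  unfolding square_def using emeasure_cbox_2[of x "x + \<rho>" y "y + \<rho>"] assms
  by (auto simp: power2_eq_square)

text \<open>Lines are described by slopes, since incidences with a grid are an arithmetic matter there.
  By \<open>dist_slope_dir_le\<close> and \<open>slope_diff_le_dist\<close> the passage to unit vectors is
  bi-Lipschitz on slopes in \<open>[0,1]\<close>, so covering numbers may be computed for slopes.\<close>
definition slope_dir :: "real \<Rightarrow> real^2" where
  "slope_dir s = (1 / sqrt (1 + s\<^sup>2)) *\<^sub>R vector [1, s]"

lemma slope_dir_component [simp]:
  "slope_dir s $ 1 = 1 / sqrt (1 + s\<^sup>2)" "slope_dir s $ 2 = s / sqrt (1 + s\<^sup>2)"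
  by (simp_all add: slope_dir_def)

lemma norm_vec2: "norm (v::real^2) = sqrt ((v$1)\<^sup>2 + (v$2)\<^sup>2)"
  by (simp add: norm_vec_def L2_set_def sum_2)

lemma norm_slope_dir: "norm (slope_dir s) = 1"
proof -
  have "norm (vector [1,s] :: real^2) = sqrt (1 + s\<^sup>2)" by (simp add: norm_vec2)
  moreover have "1 + s\<^sup>2 > 0" by (simp add: add_pos_nonneg)
  ultimately show ?thesis by (simp add: slope_dir_def)
qed

lemma norm_normalized_diff_le:
  fixes u v :: "'a::real_normed_vector"
  assumes "1 \<le> norm u" "v \<noteq> 0"
  shows "norm ((1 / norm u) *\<^sub>R u - (1 / norm v) *\<^sub>R v) \<le> 2 * norm (u - v)"
proof -
  define a b where "a = norm u" and "b = norm v"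
  have ab: "1 \<le> a" "0 < b" using assms by (auto simp: a_def b_def)
  have "(1/a) *\<^sub>R u - (1/b) *\<^sub>R v = (1/a) *\<^sub>R (u - v) + (1/a - 1/b) *\<^sub>R v"
    by (simp add: scaleR_diff_right scaleR_diff_left)
  then have "norm ((1/a) *\<^sub>R u - (1/b) *\<^sub>R v) \<le> norm ((1/a) *\<^sub>R (u - v)) + norm ((1/a - 1/b) *\<^sub>R v)"
    by (metis norm_triangle_ineq)
  also have "norm ((1/a) *\<^sub>R (u - v)) = norm (u - v) / a" using ab by simp
  also have "norm ((1/a - 1/b) *\<^sub>R v) = \<bar>b - a\<bar> / a"
  proof -
    have "(1/a - 1/b) = (b - a) / (a * b)" using ab by (simp add: diff_frac_eq)
    then have "\<bar>1/a - 1/b\<bar> * b = \<bar>b - a\<bar> / a" using ab by (simp add: abs_mult)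
    then show ?thesis by (simp add: b_def)
  qed
  also have "\<bar>b - a\<bar> / a \<le> norm (u - v) / a"
    using norm_triangle_ineq3[of v u] ab by (simp add: divide_right_mono a_def b_def norm_minus_commute)
  also have "norm (u - v) / a \<le> norm (u - v)"
    using ab divide_left_mono[of 1 a "norm (u - v)"] by simp
  finally show ?thesis by (simp add: a_def b_def)
qed

lemma dist_slope_dir_le: "dist (slope_dir s) (slope_dir t) \<le> 2 * \<bar>s - t\<bar>"
proof -
  have n: "norm (vector [1,s] :: real^2) = sqrt (1 + s\<^sup>2)" for s :: real
    by (simp add: norm_vec2)
  have "norm (vector [1,s] - vector [1,t] :: real^2) = \<bar>s - t\<bar>" by (simp add: norm_vec2)
  moreover have "1 \<le> norm (vector [1,s] :: real^2)" unfolding n by simp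
  moreover have "vector [1,t] \<noteq> (0::real^2)" by (simp add: vec_eq_iff forall_2)
  ultimately show ?thesis
    using norm_normalized_diff_le[of "vector [1,s] :: real^2" "vector [1,t]"]
    by (simp add: dist_norm slope_dir_def n)
qed

text \<open>The cross product of \<open>(1,s)\<close> and \<open>(1,t)\<close> is \<open>t - s\<close>. Normalisation divides it by at most \<open>2\<close>, and the cross
  product of two unit vectors is at most their distance.\<close>
lemma slope_diff_le_dist:
  assumes "0 \<le> s" "s \<le> 1" "0 \<le> t" "t \<le> 1"
  shows "\<bar>s - t\<bar> \<le> 2 * dist (slope_dir s) (slope_dir t)"
proof -
  define a b where "a = sqrt (1 + s\<^sup>2)" and "b = sqrt (1 + t\<^sup>2)"
  define e where "e = slope_dir t - slope_dir s"
  have s2: "s\<^sup>2 \<le> 1" "t\<^sup>2 \<le> 1" using assms by (simp_all add: power_le_one)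
  have ab: "1 \<le> a" "a \<le> sqrt 2" "1 \<le> b" "b \<le> sqrt 2"
    using s2 by (auto simp: a_def b_def)
  have "a * b \<le> sqrt 2 * sqrt 2" using ab by (intro mult_mono) auto
  then have ab2: "a * b \<le> 2" by simp
  have "(1/a) * e$2 - (s/a) * e$1 = (t - s) / (a * b)"
    using ab by (simp add: e_def a_def[symmetric] b_def[symmetric] field_simps)
  moreover have "\<bar>(1/a) * e$2 - (s/a) * e$1\<bar> \<le> norm e"
  proof -
    have "(1/a)\<^sup>2 + (s/a)\<^sup>2 = (1 + s\<^sup>2) / a\<^sup>2" by (simp add: power_divide add_divide_distrib)
    also have "\<dots> = 1" by (simp add: a_def add_pos_nonneg less_imp_neq[symmetric])
    finally have one: "(1/a)\<^sup>2 + (s/a)\<^sup>2 = 1" .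
    \<comment> \<open>Lagrange's identity: the cross and inner product with a unit vector have square sum \<open>(norm e)\<^sup>2\<close>.\<close>
    define P Q where "P = (1/a) * e$2 - (s/a) * e$1" and "Q = (1/a) * e$1 + (s/a) * e$2"
    have "((1/a) * e$2 - (s/a) * e$1)\<^sup>2 + ((1/a) * e$1 + (s/a) * e$2)\<^sup>2
        = ((1/a)\<^sup>2 + (s/a)\<^sup>2) * ((e$1)\<^sup>2 + (e$2)\<^sup>2)" by algebra
    then have "P\<^sup>2 + Q\<^sup>2 = (e$1)\<^sup>2 + (e$2)\<^sup>2" by (simp only: one P_def Q_def mult_1)
    then have "\<bar>P\<bar>\<^sup>2 \<le> (e$1)\<^sup>2 + (e$2)\<^sup>2"
      using zero_le_power2[of Q] unfolding power2_abs by linarith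
    then show ?thesis unfolding norm_vec2 P_def by (rule real_le_rsqrt)
  qed
  ultimately have "\<bar>t - s\<bar> / (a * b) \<le> norm e" using ab by (simp add: abs_mult)
  then have "\<bar>t - s\<bar> \<le> norm e * (a * b)" using ab by (simp add: field_simps)
  also have "\<dots> \<le> norm e * 2" using ab2 by (intro mult_left_mono) auto
  finally show ?thesis by (simp add: e_def dist_norm norm_minus_commute abs_minus_commute)
qed

text \<open>A line of slope at most \<open>1/2\<close> moves horizontally by \<open>2/5\<close> within length
  \<open>2/5 * sqrt (5/4) < 1/2\<close>, so it does not leave the segment at the core of the tube.\<close>
lemma square_in_tube:
  assumes "\<bar>s\<bar> \<le> 1/2" "\<bar>x - x'\<bar> \<le> 2/5"
    and "\<bar>z$1 - x'\<bar> \<le> \<rho>" "\<bar>z$2 - (y + s * (x' - x))\<bar> \<le> 3 * \<rho>"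
  shows "z \<in> tube (8 * \<rho>) (vector [x,y]) (slope_dir s)"
proof -
  define c where "c = (vector [x,y] :: real^2)"
  define a where "a = sqrt (1 + s\<^sup>2)"
  \<comment> \<open>the point of the line through the centre that lies above the abscissa \<open>x'\<close>\<close>
  define p where "p = (vector [x', y + s * (x' - x)] :: real^2)"
  define t where "t = (x' - x) * a"
  have "s\<^sup>2 \<le> (1/2)\<^sup>2" using assms(1) by (metis abs_le_square_iff abs_of_nonneg zero_le_divide_1_iff zero_le_numeral)
  then have "1 + s\<^sup>2 \<le> (5/4)\<^sup>2" by (simp add: power2_eq_square)
  then have "a \<le> sqrt ((5/4)\<^sup>2)" unfolding a_def by (rule real_sqrt_le_mono)
  then have a: "a \<le> 5/4" "a > 0" unfolding a_def by (simp_all add: add_pos_nonneg del: real_sqrt_le_iff)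
  have "\<bar>t\<bar> \<le> 2/5 * (5/4)" unfolding t_def abs_mult using assms(2) a
    by (intro mult_mono) (simp_all add: abs_minus_commute)
  then have t: "0 \<le> t + 1/2" "t + 1/2 \<le> 1" by auto
  have p: "p = c + t *\<^sub>R slope_dir s"
    using a by (simp add: vec_eq_iff forall_2 p_def c_def t_def a_def[symmetric])
  have "p \<in> closed_segment (c - (1/2) *\<^sub>R slope_dir s) (c + (1/2) *\<^sub>R slope_dir s)"
    unfolding in_segment
    by (rule exI[of _ "t + 1/2"]) (use t in \<open>auto simp: p vec_eq_iff forall_2 algebra_simps\<close>)
  moreover have "dist z p \<le> 4 * \<rho>"
    using norm_le_l1_cart[of "z - p"] assms(3,4) by (simp add: dist_norm sum_2 p_def)
  ultimately have "infdist z (closed_segment (c - (1/2) *\<^sub>R slope_dir s) (c + (1/2) *\<^sub>R slope_dir s)) \<le> 4 * \<rho>"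
    by (rule infdist_le2)
  then show ?thesis by (simp add: tube_def c_def)
qed

text \<open>Up to a constant this is the area of a rectangle with sides \<open>1\<close> and \<open>d\<close>. Covering the tube by
  about \<open>1/d\<close> squares of side \<open>3 d\<close>, centred at points along the core at distance \<open>d\<close>, avoids rotating
  the tube.\<close>
lemma emeasure_tube_le:
  assumes w: "norm w = 1" and d: "0 < d" "d \<le> 1"
  shows "emeasure lebesgue (tube d x w) \<le> ennreal (18 * d)"
proof -
  define p where "p i = x - (1/2) *\<^sub>R w + (real i * d) *\<^sub>R w" for i :: nat
  define N where "N = nat \<lfloor>1/d\<rfloor>"
  define Q where "Q i = {z::real^2. p i$1 - 3/2*d \<le> z$1 \<and> z$1 \<le> p i$1 + 3/2*d \<and>
                               p i$2 - 3/2*d \<le> z$2 \<and> z$2 \<le> p i$2 + 3/2*d}" for i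
  have Q: "emeasure lebesgue (Q i) = ennreal (9 * d\<^sup>2)" "Q i \<in> sets lebesgue" for i
    unfolding Q_def using emeasure_cbox_2[of "p i$1 - 3/2*d" "p i$1 + 3/2*d" "p i$2 - 3/2*d" "p i$2 + 3/2*d"] d
    by (auto simp: power2_eq_square)
  have "tube d x w \<subseteq> (\<Union>i\<in>{..N}. Q i)"
  proof
    fix z assume z: "z \<in> tube d x w"
    let ?S = "closed_segment (x - (1/2) *\<^sub>R w) (x + (1/2) *\<^sub>R w)"
    obtain y where y: "y \<in> ?S" "infdist z ?S = dist z y"
      using infdist_attains_inf[of ?S z] by auto
    then obtain u where u: "0 \<le> u" "u \<le> 1" "y = (1-u) *\<^sub>R (x - (1/2) *\<^sub>R w) + u *\<^sub>R (x + (1/2) *\<^sub>R w)"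
      unfolding in_segment by auto
    then have yu: "y = x - (1/2) *\<^sub>R w + u *\<^sub>R w"
      by (simp add: vec_eq_iff forall_2) (simp add: field_simps)
    define i where "i = nat \<lfloor>u/d\<rfloor>"
    have i: "real i \<le> u/d" "u/d < real i + 1" using u d by (simp_all add: i_def)
    then have iu: "real i * d \<le> u" "u \<le> real i * d + d" using d by (simp_all add: field_simps)
    have "u/d \<le> 1/d" using u d by (simp add: divide_right_mono)
    then have "i \<in> {..N}" by (auto simp: i_def N_def intro!: nat_mono floor_mono)
    moreover have "dist z (p i) \<le> 3/2 * d"
    proof -
      have "y - p i = (u - real i * d) *\<^sub>R w" by (simp add: yu p_def algebra_simps)
      then have "dist y (p i) \<le> d" using w iu by (simp add: dist_norm)
      moreover have "dist z y \<le> d/2" using z y(2) by (simp add: tube_def)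
      ultimately show ?thesis using dist_triangle[of z "p i" y] by linarith
    qed
    then have "z \<in> Q i"
      using component_le_norm_cart[of "z - p i" 1] component_le_norm_cart[of "z - p i" 2]
      by (auto simp: Q_def dist_norm abs_le_iff)
    ultimately show "z \<in> (\<Union>i\<in>{..N}. Q i)" by blast
  qed
  then have "emeasure lebesgue (tube d x w) \<le> emeasure lebesgue (\<Union>i\<in>{..N}. Q i)"
    using Q by (intro emeasure_mono) auto
  also have "\<dots> \<le> (\<Sum>i\<in>{..N}. emeasure lebesgue (Q i))"
    using Q by (intro emeasure_subadditive_finite) auto
  also have "\<dots> = ennreal (real (N+1) * (9 * d\<^sup>2))"
    by (simp only: Q) (simp add: ennreal_of_nat_eq_real_of_nat ennreal_mult' add.commute flip: ennreal_1 ennreal_plus)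
  also have "\<dots> \<le> ennreal (18 * d)"
  proof (rule ennreal_leI)
    have "real N \<le> 1/d" using d by (simp add: N_def)
    then have "real (N+1) \<le> 2/d" using d by (simp add: field_simps)
    then have "real (N+1) * (9 * d\<^sup>2) \<le> 2/d * (9 * d\<^sup>2)" by (intro mult_right_mono) auto
    then show "real (N+1) * (9 * d\<^sup>2) \<le> 18 * d" using d by (simp add: power2_eq_square)
  qed
  finally show ?thesis .
qed


section \<open>Digit sums and Cantor sets of slopes\<close>

text \<open>Truncated expansions in powers of \<open>z\<close> with digits up to \<open>D\<close>. They describe the slopes, the
  abscissae and the ordinates of the grid, which differ in the number of digits and in the factor \<open>c\<close>.\<close>
definition digit_sums :: "nat \<Rightarrow> real \<Rightarrow> real \<Rightarrow> nat \<Rightarrow> real set" where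
  "digit_sums D c z l = {c * (\<Sum>i<l. real (m i) * z ^ i) | m. \<forall>i. m i \<le> D}"

lemma digit_sums_0 [simp]: "digit_sums D c z 0 = {0}"
  by (auto simp: digit_sums_def)

text \<open>Splitting off the leading digit exhibits the self-similarity on which all inductions
  below rest.\<close>
lemma digit_sums_Suc:
  "digit_sums D c z (Suc l) = (\<lambda>(k, p). c * real k + z * p) ` ({..D} \<times> digit_sums D c z l)"
  (is "?L = ?R")
proof -
  have eq: "c * (\<Sum>i<Suc l. real (m i) * z ^ i)
     = c * real (m 0) + z * (c * (\<Sum>i<l. real (m (Suc i)) * z ^ i))" for m :: "nat \<Rightarrow> nat"
    unfolding sum.lessThan_Suc_shift by (simp add: sum_distrib_left algebra_simps)
  show ?thesis
  proof (intro equalityI subsetI)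
    fix s assume "s \<in> ?L"
    then obtain m where m: "\<forall>i. m i \<le> D" "s = c * (\<Sum>i<Suc l. real (m i) * z ^ i)"
      unfolding digit_sums_def by blast
    then have "c * (\<Sum>i<l. real (m (Suc i)) * z ^ i) \<in> digit_sums D c z l"
      unfolding digit_sums_def by (intro CollectI exI[of _ "\<lambda>i. m (Suc i)"]) auto
    then show "s \<in> ?R" unfolding m(2) eq using m(1)
      by (intro image_eqI[of _ _ "(m 0, c * (\<Sum>i<l. real (m (Suc i)) * z ^ i))"]) auto
  next
    fix s assume "s \<in> ?R"
    then obtain k m where *: "k \<le> D" "\<forall>i. m i \<le> D"
      "s = c * real k + z * (c * (\<Sum>i<l. real (m i) * z ^ i))"
      unfolding digit_sums_def by auto
    then have "s = c * (\<Sum>i<Suc l. real ((case_nat k m) i) * z ^ i)"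
      unfolding eq by simp
    then show "s \<in> ?L" using * unfolding digit_sums_def
      by (intro CollectI exI[of _ "case_nat k m"]) (auto split: nat.split)
  qed
qed

lemma finite_digit_sums [simp]: "finite (digit_sums D c z l)"
  by (induction l) (simp_all add: digit_sums_Suc)

lemma card_digit_sums: "card (digit_sums D c z l) \<le> (D + 1) ^ l"
proof (induction l)
  case (Suc l)
  have "card (digit_sums D c z (Suc l)) \<le> card ({..D} \<times> digit_sums D c z l)"
    unfolding digit_sums_Suc by (intro card_image_le) auto
  also have "\<dots> \<le> (D + 1) * (D + 1) ^ l"
    using mult_le_mono2[OF Suc, of "D + 1"]
    by (simp only: card_cartesian_product card_atMost Suc_eq_plus1)
  finally show ?case by simp
qed simp

text \<open>With about \<open>4 A\<close> digits and contraction \<open>A ^ -3\<close> this is, up to factors that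
  depend on \<open>A\<close> and the depth only, a set of dimension \<open>1/3\<close>. Up to carries it uses only every third place
  of the expansion in base \<open>A\<close>. The factor \<open>4\<close> in the number of digits is what makes greedy expansions possible later.\<close>
definition cantor_slopes :: "nat \<Rightarrow> nat \<Rightarrow> real set" where
  "cantor_slopes A = digit_sums (4 * A) (1 / real A) (1 / real A ^ 3)"

lemma cantor_slopes_0: "cantor_slopes A 0 = {0}"
  by (simp add: cantor_slopes_def)

lemma cantor_slopes_Suc:
  "cantor_slopes A (Suc l) = (\<lambda>(m, p). real m / real A + (1 / real A ^ 3) * p) ` ({..4 * A} \<times> cantor_slopes A l)"
  by (simp add: cantor_slopes_def digit_sums_Suc)

lemma finite_cantor_slopes: "finite (cantor_slopes A l)"
  by (simp add: cantor_slopes_def)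

lemma card_cantor_slopes: "card (cantor_slopes A l) \<le> (4 * A + 1) ^ l"
  unfolding cantor_slopes_def by (rule card_digit_sums)

lemma zero_in_cantor_slopes: "0 \<in> cantor_slopes A l"
  unfolding cantor_slopes_def digit_sums_def by (intro CollectI exI[of _ "\<lambda>_. 0"]) simp

lemma cantor_slopes_bounds:
  assumes "2 \<le> A" "p \<in> cantor_slopes A l"
  shows "0 \<le> p" "p \<le> 5"
proof -
  have "0 \<le> p \<and> p \<le> 5" using assms(2)
  proof (induction l arbitrary: p)
    case (Suc l)
    then obtain m q where *: "m \<le> 4 * A" "q \<in> cantor_slopes A l" "p = real m / real A + (1 / real A ^ 3) * q"
      by (auto simp: cantor_slopes_Suc)
    have q: "0 \<le> q" "q \<le> 5" using Suc.IH[OF *(2)] by auto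
    have "real m / real A \<le> 4" using *(1) assms(1) by (simp add: divide_le_eq)
    moreover have "(2::real) ^ 3 \<le> real A ^ 3" using assms(1) by (intro power_mono) auto
    then have "(1 / real A ^ 3) * q \<le> (1/8) * 5"
      using q by (intro mult_mono) (auto simp: divide_simps)
    moreover have "0 \<le> real m / real A" "0 \<le> (1 / real A ^ 3) * q" using q by auto
    ultimately show ?case unfolding *(3) by linarith
  qed (simp add: cantor_slopes_0)
  then show "0 \<le> p" "p \<le> 5" by auto
qed

lemma cantor_slopes_prefix:
  assumes "2 \<le> A" "l \<le> K" "p \<in> cantor_slopes A K"
  shows "\<exists>q\<in>cantor_slopes A l. q \<le> p \<and> p \<le> q + 5 * (1 / real A ^ 3) ^ l"
  using assms(2,3)
proof (induction l arbitrary: K p)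
  case 0
  then show ?case using cantor_slopes_bounds[OF assms(1)] by (auto simp: cantor_slopes_0)
next
  case (Suc l)
  then obtain K' where K': "K = Suc K'" "l \<le> K'" by (cases K) auto
  then obtain m p' where *: "m \<le> 4 * A" "p' \<in> cantor_slopes A K'" "p = real m / real A + (1 / real A ^ 3) * p'"
    using Suc.prems by (auto simp: cantor_slopes_Suc)
  obtain q where q: "q \<in> cantor_slopes A l" "q \<le> p'" "p' \<le> q + 5 * (1 / real A ^ 3) ^ l"
    using Suc.IH[OF K'(2) *(2)] by blast
  define z where "z = 1 / real A ^ 3"
  have "z \<ge> 0" by (simp add: z_def)
  then have "z * q \<le> z * p'" "z * p' \<le> z * (q + 5 * z ^ l)"
    using q unfolding z_def by (intro mult_left_mono; simp)+
  moreover have "real m / real A + z * q \<in> cantor_slopes A (Suc l)"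
    unfolding cantor_slopes_Suc z_def using *(1) q(1) by (force intro: image_eqI)
  ultimately show ?case using *(3) unfolding z_def[symmetric]
    by (intro bexI[of _ "real m / real A + z * q"]) (auto simp: algebra_simps)
qed

text \<open>Pieces with different leading digits are further apart than \<open>A ^ -3\<close>, so an
  interval of length \<open>A ^ (-3 k)\<close> determines the first \<open>k\<close> digits and leaves only the remaining ones
  free.\<close>
lemma card_cantor_slopes_interval:
  assumes "4 \<le> A" "k \<le> l"
  shows "card (cantor_slopes A l \<inter> {a..a + (1 / real A ^ 3) ^ k}) \<le> (4 * A + 1) ^ (l - k)"
  using assms(2)
proof (induction k arbitrary: l a)
  case 0
  have "card (cantor_slopes A l \<inter> {a..a + (1 / real A ^ 3) ^ 0}) \<le> card (cantor_slopes A l)"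
    by (intro card_mono finite_cantor_slopes) auto
  also note card_cantor_slopes
  finally show ?case by simp
next
  case (Suc k)
  then obtain l' where l': "l = Suc l'" "k \<le> l'" by (cases l) auto
  define z where "z = 1 / real A ^ 3"
  define I where "I = {a..a + z ^ Suc k}"
  have z: "0 < z" "z \<le> 1" using assms(1) by (auto simp: z_def divide_le_eq)
  have zk: "z ^ Suc k \<le> z" using z by (simp add: mult_left_le power_le_one)
  have z6: "6 * z < 1 / real A"
  proof -
    have "(4::real) * 4 \<le> real A * real A" using assms(1) by (intro mult_mono) auto
    then show ?thesis using assms(1) by (simp add: z_def power3_eq_cube field_simps)
  qed
  show ?case
  proof (cases "cantor_slopes A l \<inter> I = {}")
    case True then show ?thesis by (simp add: I_def z_def)
  next
    case False
    then obtain m0 p0 where 0: "p0 \<in> cantor_slopes A l'" "real m0 / real A + z * p0 \<in> I"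
      unfolding l'(1) cantor_slopes_Suc z_def by auto
    define a' where "a' = (a - real m0 / real A) / z"
    have "cantor_slopes A l \<inter> I \<subseteq> (\<lambda>p. real m0 / real A + z * p) ` (cantor_slopes A l' \<inter> {a'..a' + z ^ k})"
    proof
      fix s assume s: "s \<in> cantor_slopes A l \<inter> I"
      then obtain m p where p: "p \<in> cantor_slopes A l'" "s = real m / real A + z * p"
        unfolding l'(1) cantor_slopes_Suc z_def by auto
      have pb: "0 \<le> z * p" "z * p \<le> z * 5" "0 \<le> z * p0" "z * p0 \<le> z * 5"
        using cantor_slopes_bounds[of A] assms(1) p(1) 0(1) z by (auto intro!: mult_left_mono)
      \<comment> \<open>\<open>I\<close> meets the piece with leading digit \<open>m0\<close>, so it meets no other piece\<close>
      have "m = m0"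
      proof (rule ccontr)
        assume "m \<noteq> m0"
        then have "1 \<le> \<bar>real m - real m0\<bar>" by linarith
        then have "1 / real A \<le> \<bar>real m - real m0\<bar> / real A" by (intro divide_right_mono) auto
        also have "\<dots> = \<bar>real m / real A - real m0 / real A\<bar>" by (simp add: diff_divide_distrib[symmetric])
        also have "\<dots> \<le> 6 * z"
          using s 0(2) p(2) pb zk unfolding I_def by auto
        finally show False using z6 by linarith
      qed
      moreover have "a' \<le> p" "p \<le> a' + z ^ k"
        using s z unfolding I_def p(2) \<open>m = m0\<close> a'_def by (auto simp: field_simps)
      ultimately show "s \<in> (\<lambda>p. real m0 / real A + z * p) ` (cantor_slopes A l' \<inter> {a'..a' + z ^ k})"
        using p by auto
    qed
    then have "card (cantor_slopes A l \<inter> I) \<le> card (cantor_slopes A l' \<inter> {a'..a' + z ^ k})"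
      by (meson surj_card_le finite_Int finite_cantor_slopes)
    also have "\<dots> \<le> (4 * A + 1) ^ (l' - k)" using Suc.IH[OF l'(2)] unfolding z_def .
    finally show ?thesis by (simp add: l'(1) I_def z_def)
  qed
qed

text \<open>The centres are the truncations after \<open>l\<close> digits, where \<open>A ^ (-3 l)\<close> is comparable to \<open>\<sigma>\<close>. If
  \<open>A ^ (-3 k)\<close> is comparable to \<open>\<rho>\<close>, then the previous lemma leaves about
  \<open>A ^ (l - k) = (\<rho> / \<sigma>) powr (1/3)\<close> of them. Rounding both scales to powers of \<open>A ^ 3\<close> costs the
  factor \<open>A ^ 2\<close>, and having \<open>4 A + 1\<close> digits instead of \<open>A\<close> costs \<open>5 ^ K\<close>.\<close>
lemma cantor_slopes_cover:
  assumes A: "4 \<le> A" and \<sigma>: "0 < \<sigma>" "\<sigma> \<le> \<rho>"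
  shows "\<exists>Q. finite Q \<and> real (card Q) \<le> 3 * 5 ^ K * real A ^ 2 * (\<rho> / \<sigma>) powr (1/3) \<and>
             (\<forall>p\<in>cantor_slopes A K. \<bar>p - a\<bar> \<le> \<rho> \<longrightarrow> (\<exists>q\<in>Q. \<bar>p - q\<bar> \<le> \<sigma>))"
proof -
  define z where "z = 1 / real A ^ 3"
  have z: "0 < z" "z < 1" using A by (auto simp: z_def divide_less_eq)
  define l where "l = (LEAST l. 5 * z ^ l \<le> \<sigma> \<or> l = K)"
  have l: "5 * z ^ l \<le> \<sigma> \<or> l = K" unfolding l_def by (rule LeastI[of _ K]) simp
  have lmin: "\<not> (5 * z ^ i \<le> \<sigma> \<or> i = K)" if "i < l" for i
    using that unfolding l_def by (rule not_less_Least)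
  have lK: "l \<le> K" unfolding l_def by (rule Least_le) simp
  \<comment> \<open>with \<open>k = 0\<close> as default: if \<open>3 * \<rho>\<close> exceeds \<open>z\<close>, then no digit is determined\<close>
  define k where "k = Max {k. k \<le> l \<and> (k = 0 \<or> 3 * \<rho> \<le> z ^ k)}"
  have fin: "finite {k. k \<le> l \<and> (k = 0 \<or> 3 * \<rho> \<le> z ^ k)}" by (rule finite_subset[of _ "{..l}"]) auto
  have "k \<in> {k. k \<le> l \<and> (k = 0 \<or> 3 * \<rho> \<le> z ^ k)}" unfolding k_def using fin by (intro Max_in) auto
  then have k: "k \<le> l" "k = 0 \<or> 3 * \<rho> \<le> z ^ k" by auto
  have kmax: "z ^ Suc k < 3 * \<rho>" if "k < l"
  proof (rule ccontr)
    assume "\<not> z ^ Suc k < 3 * \<rho>"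
    then have "Suc k \<in> {k. k \<le> l \<and> (k = 0 \<or> 3 * \<rho> \<le> z ^ k)}" using that by auto
    then have "Suc k \<le> k" unfolding k_def by (intro Max_ge fin)
    then show False by simp
  qed
  define Q where "Q = cantor_slopes A l \<inter> {a - \<rho> - \<sigma>..a + \<rho>}"
  have "card Q \<le> (4 * A + 1) ^ (l - k)"
  proof (cases "k = 0")
    case True
    have "card Q \<le> card (cantor_slopes A l)" unfolding Q_def by (intro card_mono finite_cantor_slopes) auto
    then show ?thesis using card_cantor_slopes[of A l] True by simp
  next
    case False
    have "card Q \<le> card (cantor_slopes A l \<inter> {a - \<rho> - \<sigma>..(a - \<rho> - \<sigma>) + z ^ k})"
      unfolding Q_def using k(2) False \<sigma> by (intro card_mono finite_Int disjI1 finite_cantor_slopes) auto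
    also have "\<dots> \<le> (4 * A + 1) ^ (l - k)" unfolding z_def by (rule card_cantor_slopes_interval[OF A k(1)])
    finally show ?thesis .
  qed
  also have "\<dots> \<le> (5 * A) ^ (l - k)" using A by (intro power_mono) auto
  finally have "real (card Q) \<le> (5 * real A) ^ (l - k)" by (metis of_nat_le_iff of_nat_power of_nat_mult of_nat_numeral)
  also have "\<dots> = 5 ^ (l - k) * real A ^ (l - k)" by (simp add: power_mult_distrib)
  also have "\<dots> \<le> 5 ^ K * (3 * real A ^ 2 * (\<rho> / \<sigma>) powr (1/3))"
  proof (intro mult_mono power_increasing)
    show "real A ^ (l - k) \<le> 3 * real A ^ 2 * (\<rho> / \<sigma>) powr (1/3)"
    proof (cases "k < l")
      case False
      have "1 * 1 * 1 \<le> 3 * real A ^ 2 * (\<rho> / \<sigma>) powr (1/3)"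
        using A \<sigma> by (intro mult_mono ge_one_powr_ge_zero) (auto simp: le_divide_eq)
      then show ?thesis using False by simp
    next
      case True
      then obtain l' where l': "l = Suc l'" by (cases l) auto
      have 1: "\<sigma> < 5 * z ^ l'" using lmin[of l'] l' by auto
      have "(real A ^ (l - k)) ^ 3 = (1 / z) ^ (l - k)"
        by (simp add: z_def flip: power_mult) (simp add: mult.commute)
      also have "\<dots> = z ^ Suc k / z ^ l' * (1/z) ^ 2"
      proof -
        have "z ^ l' = z ^ k * z ^ (l' - k)" using True l' by (simp flip: power_add)
        moreover have "l - k = Suc (l' - k)" using True l' by simp
        ultimately show ?thesis using z by (simp add: field_simps power2_eq_square)
      qed
      also have "\<dots> \<le> (3 * \<rho>) / (\<sigma> / 5) * (1/z) ^ 2"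
        using kmax[OF True] 1 \<sigma> z by (intro mult_right_mono frac_le) auto
      also have "\<dots> = 15 * (\<rho> / \<sigma>) * (real A ^ 2) ^ 3" by (simp add: z_def flip: power_mult)
      also have "\<dots> \<le> 27 * (\<rho> / \<sigma>) * (real A ^ 2) ^ 3" using \<sigma> by (intro mult_right_mono) auto
      also have "\<dots> = (3 * real A ^ 2 * (\<rho> / \<sigma>) powr (1/3)) ^ 3"
      proof -
        have "((\<rho> / \<sigma>) powr (1/3)) ^ 3 = \<rho> / \<sigma>" using \<sigma> by (simp add: powr_power)
        then show ?thesis by (simp add: power_mult_distrib)
      qed
      finally show ?thesis by (rule power_le_imp_le_base[of _ 2, simplified]) simp
    qed
  qed (use lK in auto)
  finally have card: "real (card Q) \<le> 3 * 5 ^ K * real A ^ 2 * (\<rho> / \<sigma>) powr (1/3)" by (simp add: mult_ac)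
  moreover have "\<exists>q\<in>Q. \<bar>p - q\<bar> \<le> \<sigma>" if p: "p \<in> cantor_slopes A K" "\<bar>p - a\<bar> \<le> \<rho>" for p
  proof -
    obtain q where q: "q \<in> cantor_slopes A l" "q \<le> p" "p \<le> q + \<sigma>"
    proof (cases "l = K")
      case True
      then show ?thesis using that[of p] p \<sigma> by auto
    next
      case False
      then show ?thesis using l cantor_slopes_prefix[OF _ lK p(1)] A that unfolding z_def[symmetric] by force
    qed
    then show ?thesis using p(2) unfolding Q_def by (intro bexI[of _ q]) auto
  qed
  moreover have "finite Q" by (simp add: Q_def finite_cantor_slopes)
  ultimately show ?thesis by blast
qed


section \<open>Unions of dilated Cantor sets\<close>

definition union_slopes :: "(nat \<Rightarrow> nat) \<Rightarrow> (nat \<Rightarrow> nat) \<Rightarrow> (nat \<Rightarrow> real) \<Rightarrow> real set" where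
  "union_slopes A K \<eta> = (\<Union>n. (\<lambda>p. \<eta> n * p) ` cantor_slopes (A n) (K n))"

text \<open>Pieces with \<open>5 * \<eta> n \<le> \<sigma>\<close> lie in the \<open>\<sigma>\<close>-neighbourhood of \<open>0\<close>, so one centre takes
  care of all of them. For any other piece \<open>1 \<le> (5 * \<eta> n / \<sigma>) powr \<tau>\<close>. Inserting this factor makes
  the losses \<open>5 ^ K n * A n ^ 2\<close> of the single pieces summable at the price of \<open>(1/\<sigma>) powr \<tau>\<close>,
  with a constant that depends on \<open>\<tau>\<close> only.\<close>
lemma union_slopes_cover:
  assumes A: "\<And>n. 4 \<le> A n" and \<eta>: "\<And>n. 0 < \<eta> n" and "0 < \<tau>"
    and sum: "summable (\<lambda>n. 5 ^ K n * real (A n) ^ 2 * \<eta> n powr \<tau>)"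
  shows "\<exists>C>0. \<forall>a \<sigma> \<rho>. 0 < \<sigma> \<longrightarrow> \<sigma> \<le> \<rho> \<longrightarrow>
     (\<exists>Q. finite Q \<and> real (card Q) \<le> C * (1/\<sigma>) powr \<tau> * (\<rho>/\<sigma>) powr (1/3) + 1 \<and>
          (\<forall>s\<in>union_slopes A K \<eta>. \<bar>s - a\<bar> \<le> \<rho> \<longrightarrow> (\<exists>q\<in>Q. \<bar>s - q\<bar> \<le> \<sigma>)))"
proof -
  define b where "b n = 5 ^ K n * real (A n) ^ 2 * \<eta> n powr \<tau>" for n
  have A0: "0 < A n" for n using A[of n] by linarith
  have b: "0 < b n" for n unfolding b_def using A0[of n] \<eta>[of n] by simp
  have sb: "summable b" using sum unfolding b_def .
  define C where "C = 3 * 5 powr \<tau> * suminf b"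
  have C: "C > 0" unfolding C_def using suminf_pos[OF sb b] by simp
  have "\<exists>Q. finite Q \<and> real (card Q) \<le> C * (1/\<sigma>) powr \<tau> * (\<rho>/\<sigma>) powr (1/3) + 1 \<and>
          (\<forall>s\<in>union_slopes A K \<eta>. \<bar>s - a\<bar> \<le> \<rho> \<longrightarrow> (\<exists>q\<in>Q. \<bar>s - q\<bar> \<le> \<sigma>))"
    if \<sigma>: "0 < \<sigma>" "\<sigma> \<le> \<rho>" for a \<sigma> \<rho>
  proof -
    define N where "N = {n. \<sigma> < 5 * \<eta> n}"
    have \<eta>b: "\<eta> n powr \<tau> \<le> b n" for n
    proof -
      have "1 * 1 \<le> 5 ^ K n * real (A n) ^ 2"
        using A0[of n] by (intro mult_mono one_le_power) auto
      then show ?thesis unfolding b_def using mult_right_mono[of 1 _ "\<eta> n powr \<tau>"] by simp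
    qed
    have "eventually (\<lambda>n. b n < (\<sigma>/5) powr \<tau>) sequentially"
      using order_tendstoD(2)[OF summable_LIMSEQ_zero[OF sb]] \<sigma> by simp
    then obtain n0 where n0: "\<And>n. n \<ge> n0 \<Longrightarrow> b n < (\<sigma>/5) powr \<tau>"
      unfolding eventually_sequentially by blast
    have "N \<subseteq> {..<n0}"
    proof
      fix n assume "n \<in> N"
      then have "(\<sigma>/5) powr \<tau> \<le> \<eta> n powr \<tau>" unfolding N_def using \<sigma> \<open>0 < \<tau>\<close> by (intro powr_mono2) auto
      then show "n \<in> {..<n0}" using n0[of n] \<eta>b[of n] by force
    qed
    then have finN: "finite N" by (rule finite_subset) simp
    have "\<exists>Q. finite Q \<and> real (card Q) \<le> 3 * 5 ^ K n * real (A n) ^ 2 * (\<rho> / \<sigma>) powr (1/3) \<and>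
             (\<forall>p\<in>cantor_slopes (A n) (K n). \<bar>p - a / \<eta> n\<bar> \<le> \<rho> / \<eta> n \<longrightarrow> (\<exists>q\<in>Q. \<bar>p - q\<bar> \<le> \<sigma> / \<eta> n))" for n
      using cantor_slopes_cover[OF A, of "\<sigma> / \<eta> n" "\<rho> / \<eta> n" "K n" n "a / \<eta> n"] \<eta>[of n] \<sigma>
      by (simp add: divide_right_mono)
    then obtain Q where Q: "\<And>n. finite (Q n)"
      "\<And>n. real (card (Q n)) \<le> 3 * 5 ^ K n * real (A n) ^ 2 * (\<rho> / \<sigma>) powr (1/3)"
      "\<And>n p. p\<in>cantor_slopes (A n) (K n) \<Longrightarrow> \<bar>p - a / \<eta> n\<bar> \<le> \<rho> / \<eta> n \<Longrightarrow> (\<exists>q\<in>Q n. \<bar>p - q\<bar> \<le> \<sigma> / \<eta> n)"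
      by metis
    define U where "U = (\<Union>n\<in>N. (\<lambda>q. \<eta> n * q) ` Q n)"
    have "real (card U) \<le> real (\<Sum>n\<in>N. card ((\<lambda>q. \<eta> n * q) ` Q n))"
      unfolding U_def of_nat_le_iff by (rule card_UN_le[OF finN])
    also have "\<dots> = (\<Sum>n\<in>N. real (card ((\<lambda>q. \<eta> n * q) ` Q n)))" by simp
    also have "\<dots> \<le> (\<Sum>n\<in>N. 3 * 5 powr \<tau> * (1/\<sigma>) powr \<tau> * (\<rho>/\<sigma>) powr (1/3) * b n)"
    proof (rule sum_mono)
      fix n assume n: "n \<in> N"
      have "real (card ((\<lambda>q. \<eta> n * q) ` Q n)) \<le> real (card (Q n))"
        using card_image_le[OF Q(1)] by simp
      also have "\<dots> \<le> 3 * 5 ^ K n * real (A n) ^ 2 * (\<rho> / \<sigma>) powr (1/3)" by (rule Q(2))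
      also have "\<dots> \<le> (3 * 5 ^ K n * real (A n) ^ 2 * (\<rho> / \<sigma>) powr (1/3)) * (5 * \<eta> n / \<sigma>) powr \<tau>"
      proof -
        have "1 \<le> (5 * \<eta> n / \<sigma>) powr \<tau>"
          using n \<sigma> \<open>0 < \<tau>\<close> unfolding N_def by (intro ge_one_powr_ge_zero) auto
        from mult_left_mono[OF this, of "3 * 5 ^ K n * real (A n) ^ 2 * (\<rho> / \<sigma>) powr (1/3)"]
        show ?thesis by simp
      qed
      also have "(5 * \<eta> n / \<sigma>) powr \<tau> = 5 powr \<tau> * \<eta> n powr \<tau> * (1/\<sigma>) powr \<tau>"
        using \<sigma> \<eta>[of n] by (simp add: powr_mult powr_divide)
      finally show "real (card ((\<lambda>q. \<eta> n * q) ` Q n)) \<le> 3 * 5 powr \<tau> * (1/\<sigma>) powr \<tau> * (\<rho>/\<sigma>) powr (1/3) * b n"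
        by (simp add: b_def mult_ac)
    qed
    also have "\<dots> = 3 * 5 powr \<tau> * (1/\<sigma>) powr \<tau> * (\<rho>/\<sigma>) powr (1/3) * sum b N"
      by (simp add: sum_distrib_left)
    also have "\<dots> \<le> 3 * 5 powr \<tau> * (1/\<sigma>) powr \<tau> * (\<rho>/\<sigma>) powr (1/3) * suminf b"
      using b by (intro mult_left_mono sum_le_suminf[OF sb finN]) (auto intro: less_imp_le)
    also have "\<dots> = C * (1/\<sigma>) powr \<tau> * (\<rho>/\<sigma>) powr (1/3)" by (simp add: C_def)
    finally have cU: "real (card U) \<le> C * (1/\<sigma>) powr \<tau> * (\<rho>/\<sigma>) powr (1/3)" .
    have finU: "finite U" unfolding U_def using finN Q(1) by blast
    have "card (insert 0 U) \<le> Suc (card U)" by (rule card_insert_le_m1) simp_all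
    then have "real (card (insert 0 U)) \<le> C * (1/\<sigma>) powr \<tau> * (\<rho>/\<sigma>) powr (1/3) + 1" using cU by linarith
    moreover have "\<exists>q\<in>insert 0 U. \<bar>s - q\<bar> \<le> \<sigma>" if s: "s \<in> union_slopes A K \<eta>" "\<bar>s - a\<bar> \<le> \<rho>" for s
    proof -
      obtain n p where p: "p \<in> cantor_slopes (A n) (K n)" "s = \<eta> n * p"
        using s(1) unfolding union_slopes_def by blast
      show ?thesis
      proof (cases "n \<in> N")
        case True
        have sc: "\<bar>p - t / \<eta> n\<bar> = \<bar>s - t\<bar> / \<eta> n" for t
        proof -
          have "p - t / \<eta> n = (s - t) / \<eta> n" using \<eta>[of n] by (simp add: p(2) diff_divide_distrib)
          then show ?thesis using \<eta>[of n] by simp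
        qed
        have "\<bar>p - a / \<eta> n\<bar> \<le> \<rho> / \<eta> n" unfolding sc using s(2) \<eta>[of n] by (simp add: divide_right_mono)
        then obtain q where q: "q \<in> Q n" "\<bar>p - q\<bar> \<le> \<sigma> / \<eta> n" using Q(3)[OF p(1)] by blast
        have "\<bar>s - \<eta> n * q\<bar> \<le> \<sigma>" using q(2) sc[of "\<eta> n * q"] \<eta>[of n] by (simp add: divide_le_cancel)
        then show ?thesis using q(1) True unfolding U_def by blast
      next
        case False
        have "0 \<le> p" "p \<le> 5" using cantor_slopes_bounds[OF _ p(1)] A[of n] by auto
        then have "0 \<le> s" "s \<le> \<eta> n * 5" unfolding p(2) using \<eta>[of n] by auto
        then show ?thesis using False unfolding N_def by (intro bexI[of _ 0]) auto
      qed
    qed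
    ultimately show ?thesis using finU by (intro exI[of _ "insert 0 U"]) auto
  qed
  with C show ?thesis by blast
qed

lemma union_slopes_bounds:
  assumes "\<And>n. 4 \<le> A n" "\<And>n. 0 < \<eta> n" "\<And>n. 5 * \<eta> n \<le> c" "s \<in> union_slopes A K \<eta>"
  shows "0 \<le> s" "s \<le> c"
proof -
  obtain n p where p: "p \<in> cantor_slopes (A n) (K n)" "s = \<eta> n * p"
    using assms(4) unfolding union_slopes_def by blast
  have "0 \<le> p" "p \<le> 5" using cantor_slopes_bounds[OF _ p(1)] assms(1)[of n] by auto
  then have "0 \<le> s" "s \<le> \<eta> n * 5" unfolding p(2) using assms(2)[of n] by auto
  then show "0 \<le> s" "s \<le> c" using assms(3)[of n] by auto
qed

text \<open>For a given \<open>\<gamma>\<close> the scales satisfy \<open>(1/r) powr \<gamma> < R/r\<close>. So with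
  \<open>\<tau> = \<gamma> * (\<alpha> - 1/3)\<close> the loss \<open>(1/r) powr \<tau>\<close> is at most \<open>(R/r) powr (\<alpha> - 1/3)\<close>: this is where the
  dimension tolerates losses that are subpolynomial in \<open>r\<close>.\<close>
lemma qA_dim_union_slopes:
  assumes A: "\<And>n. 4 \<le> A n" and \<eta>: "\<And>n. 0 < \<eta> n" "\<And>n. 5 * \<eta> n \<le> 1"
    and sum: "\<And>\<tau>. 0 < \<tau> \<Longrightarrow> summable (\<lambda>n. 5 ^ K n * real (A n) ^ 2 * \<eta> n powr \<tau>)"
  shows "qA_dim (slope_dir ` union_slopes A K \<eta>) \<le> 1/3"
proof (rule qA_dim_le)
  show "slope_dir ` union_slopes A K \<eta> \<noteq> {}"
    using zero_in_cantor_slopes by (fastforce simp: union_slopes_def)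
next
  fix \<gamma> \<alpha> :: real assume \<gamma>: "0 < \<gamma>" and \<alpha>: "1/3 < \<alpha>"
  define S where "S = union_slopes A K \<eta>"
  define \<tau> where "\<tau> = \<gamma> * (\<alpha> - 1/3)"
  have \<tau>: "0 < \<tau>" using \<gamma> \<alpha> by (simp add: \<tau>_def)
  obtain C where C: "C > 0" and cover: "\<And>a \<sigma> \<rho>. 0 < \<sigma> \<Longrightarrow> \<sigma> \<le> \<rho> \<Longrightarrow>
     (\<exists>Q. finite Q \<and> real (card Q) \<le> C * (1/\<sigma>) powr \<tau> * (\<rho>/\<sigma>) powr (1/3) + 1 \<and>
          (\<forall>s\<in>S. \<bar>s - a\<bar> \<le> \<rho> \<longrightarrow> (\<exists>q\<in>Q. \<bar>s - q\<bar> \<le> \<sigma>)))"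
    using union_slopes_cover[OF A \<eta>(1) \<tau> sum[OF \<tau>]] unfolding S_def by blast
  define C' where "C' = C * 2 powr \<tau> * 4 powr (1/3) + 1"
  have "real (covering_number (cball x R \<inter> slope_dir ` S) r) \<le> C' * (R / r) powr \<alpha>"
    if x: "x \<in> slope_dir ` S" and r: "0 < r" "r < r powr (1 - \<gamma>)" "r powr (1 - \<gamma>) < R" for x r R
  proof -
    obtain s0 where s0: "s0 \<in> S" "x = slope_dir s0" using x by blast
    have Rr: "1 < R / r" using r by simp
    obtain Q where Q: "finite Q" "real (card Q) \<le> C * (1/(r/2)) powr \<tau> * (2*R/(r/2)) powr (1/3) + 1"
      "\<And>s. s \<in> S \<Longrightarrow> \<bar>s - s0\<bar> \<le> 2 * R \<Longrightarrow> \<exists>q\<in>Q. \<bar>s - q\<bar> \<le> r/2"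
      using cover[of "r/2" "2*R" s0] r by auto
    have "cball x R \<inter> slope_dir ` S \<subseteq> (\<Union>z\<in>slope_dir ` Q. cball z r)"
    proof
      fix y assume "y \<in> cball x R \<inter> slope_dir ` S"
      then obtain s where s: "s \<in> S" "y = slope_dir s" "dist (slope_dir s0) (slope_dir s) \<le> R"
        using s0 by auto
      have "0 \<le> s" "s \<le> 1" "0 \<le> s0" "s0 \<le> 1"
        using union_slopes_bounds[OF A \<eta>] s(1) s0(1) unfolding S_def by auto
      then have "\<bar>s - s0\<bar> \<le> 2 * R" using slope_diff_le_dist[of s s0] s(3) by (simp add: dist_commute)
      then obtain q where q: "q \<in> Q" "\<bar>s - q\<bar> \<le> r/2" using Q(3)[OF s(1)] by blast
      have "dist (slope_dir q) y \<le> r" using dist_slope_dir_le[of q s] q(2) s(2) by (simp add: abs_minus_commute)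
      then show "y \<in> (\<Union>z\<in>slope_dir ` Q. cball z r)" using q(1) by auto
    qed
    then have "covering_number (cball x R \<inter> slope_dir ` S) r \<le> card (slope_dir ` Q)"
      using Q(1) by (intro covering_number_le) auto
    also have "\<dots> \<le> card Q" using Q(1) by (rule card_image_le)
    finally have "real (covering_number (cball x R \<inter> slope_dir ` S) r) \<le> real (card Q)" by simp
    also have "\<dots> \<le> C * (1/(r/2)) powr \<tau> * (2*R/(r/2)) powr (1/3) + 1" by (rule Q(2))
    finally have c: "real (covering_number (cball x R \<inter> slope_dir ` S) r)
       \<le> C * (1/(r/2)) powr \<tau> * (2*R/(r/2)) powr (1/3) + 1" .
    have \<tau>_le: "(1/r) powr \<tau> \<le> (R/r) powr (\<alpha> - 1/3)"
    proof -
      have "r powr (1 - \<gamma>) / r = r powr (- \<gamma>)" using r(1) by (simp add: powr_diff powr_minus_divide)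
      moreover have "(1/r) powr \<tau> = r powr (- \<tau>)" using r(1) by (simp add: powr_divide powr_minus_divide)
      ultimately have "(1/r) powr \<tau> = (r powr (1 - \<gamma>) / r) powr (\<alpha> - 1/3)"
        unfolding \<tau>_def by (simp only: powr_powr mult_minus_left)
      also have "\<dots> \<le> (R/r) powr (\<alpha> - 1/3)" using r \<alpha> by (intro powr_mono2 divide_right_mono) auto
      finally show ?thesis .
    qed
    have "(2*R/(r/2)) powr (1/3) = 4 powr (1/3) * (R/r) powr (1/3)"
      using Rr r by (simp add: powr_mult[symmetric])
    moreover have "(1/(r/2)) powr \<tau> = 2 powr \<tau> * (1/r) powr \<tau>" using r by (simp add: powr_divide)
    ultimately have "C * (1/(r/2)) powr \<tau> * (2*R/(r/2)) powr (1/3)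
        = C * 2 powr \<tau> * 4 powr (1/3) * ((1/r) powr \<tau> * (R/r) powr (1/3))" by simp
    also have "\<dots> \<le> C * 2 powr \<tau> * 4 powr (1/3) * ((R/r) powr (\<alpha> - 1/3) * (R/r) powr (1/3))"
      using \<tau>_le C by (intro mult_left_mono mult_right_mono) auto
    also have "\<dots> = C * 2 powr \<tau> * 4 powr (1/3) * (R/r) powr \<alpha>" by (simp flip: powr_add)
    finally have "C * (1/(r/2)) powr \<tau> * (2*R/(r/2)) powr (1/3)
        \<le> C * 2 powr \<tau> * 4 powr (1/3) * (R/r) powr \<alpha>" .
    moreover have "1 \<le> (R/r) powr \<alpha>" using Rr \<alpha> by (intro ge_one_powr_ge_zero) auto
    ultimately show ?thesis using c unfolding C'_def by (simp only: distrib_right mult_1)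
  qed
  moreover have "C' > 0" using C by (simp add: C'_def add_pos_pos)
  ultimately show "\<alpha> \<in> qA_exponents (slope_dir ` union_slopes A K \<eta>) \<gamma>"
    unfolding qA_exponents_def S_def by blast
qed


section \<open>Lines through a grid\<close>

text \<open>For every \<open>x\<close> in \<open>[1/4,1]\<close> each \<open>v\<close> lies, up to \<open>A ^ (-3 K)\<close>, on a line with an admissible
  slope and intercept. One step rescales the remainder to \<open>t\<close> in \<open>[0, A ^ 3]\<close> and writes
  \<open>t = m * (A\<^sup>2 * x) + j + remainder\<close>: division by \<open>A\<^sup>2 * x\<close> gives a quotient at most \<open>A / x \<le> 4 A\<close> and a
  remainder in \<open>[0, A\<^sup>2 * x]\<close>, whose integer part is at most \<open>A\<^sup>2\<close>. Hence the tubes cover a rectangle, and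
  no estimate of their overlaps is necessary.\<close>
lemma greedy_expansion:
  fixes x v :: real
  assumes A: "1 \<le> A" and x: "1/4 \<le> x" "x \<le> 1" and v: "0 \<le> v" "v \<le> 1"
  shows "\<exists>m j \<rho>. (\<forall>i. m i \<le> 4 * A) \<and> (\<forall>i. j i \<le> A\<^sup>2) \<and> 0 \<le> \<rho> \<and> \<rho> \<le> 1 \<and>
    v = (\<Sum>i<K. (real (m i) * x / real A + real (j i) / real A ^ 3) * (1 / real A ^ 3) ^ i) + (1 / real A ^ 3) ^ K * \<rho>"
proof (induction K)
  case 0
  show ?case using v by (intro exI[of _ "\<lambda>_. 0"] exI[of _ v]) auto
next
  case (Suc K)
  define z where "z = 1 / real A ^ 3"
  obtain m j \<rho> where IH: "\<forall>i. m i \<le> 4 * A" "\<forall>i. j i \<le> A\<^sup>2" "0 \<le> \<rho>" "\<rho> \<le> 1"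
    "v = (\<Sum>i<K. (real (m i) * x / real A + real (j i) / real A ^ 3) * z ^ i) + z ^ K * \<rho>"
    using Suc unfolding z_def by blast
  define a where "a = real A"
  have a: "1 \<le> a" using A by (simp add: a_def)
  define t where "t = a ^ 3 * \<rho>"
  define d where "d = a\<^sup>2 * x"
  have d: "0 < d" "d \<le> a\<^sup>2" using a x mult_left_le[of x "a\<^sup>2"] by (auto simp: d_def)
  have t: "0 \<le> t" "t \<le> a ^ 3" using IH(3,4) a mult_left_le[of \<rho> "a ^ 3"] by (auto simp: t_def)
  define m' where "m' = nat \<lfloor>t / d\<rfloor>"
  have m': "real m' * d \<le> t" "t - real m' * d \<le> d"
  proof -
    have "0 \<le> t / d" using t d by simp
    then have "real m' \<le> t / d" "t / d < real m' + 1" unfolding m'_def by linarith+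
    then show "real m' * d \<le> t" "t - real m' * d \<le> d" using d by (simp_all add: field_simps)
  qed
  have "m' \<le> 4 * A"
  proof -
    have "a ^ 3 / d \<le> 4 * a"
      using x a by (simp add: d_def power3_eq_cube power2_eq_square field_simps)
    moreover have "t / d \<le> a ^ 3 / d" using t d by (intro divide_right_mono) auto
    ultimately have "\<lfloor>t / d\<rfloor> \<le> \<lfloor>4 * a\<rfloor>" by (intro floor_mono) linarith
    then show ?thesis unfolding m'_def a_def by (simp add: nat_le_iff) linarith
  qed
  define u where "u = t - real m' * d"
  have u: "0 \<le> u" "u \<le> a\<^sup>2" using m' d by (auto simp: u_def)
  define j' where "j' = nat \<lfloor>u\<rfloor>"
  define \<rho>' where "\<rho>' = u - real j'"
  have \<rho>': "0 \<le> \<rho>'" "\<rho>' \<le> 1" using u unfolding \<rho>'_def j'_def by linarith+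
  have "real j' \<le> a\<^sup>2" using u \<rho>' unfolding \<rho>'_def by linarith
  then have j': "j' \<le> A\<^sup>2" unfolding a_def by (metis of_nat_le_iff of_nat_power)
  have "t = real m' * (a\<^sup>2 * x) + real j' + \<rho>'" by (simp add: \<rho>'_def u_def d_def)
  then have "\<rho> = real m' * x / a + real j' / a ^ 3 + z * \<rho>'"
    using a unfolding t_def z_def a_def[symmetric]
    by (simp add: field_simps power3_eq_cube power2_eq_square)
  then have "v = (\<Sum>i<Suc K. (real ((m(K := m')) i) * x / real A + real ((j(K := j')) i) / real A ^ 3) * z ^ i) + z ^ Suc K * \<rho>'"
    unfolding IH(5) by (simp add: a_def algebra_simps)
  then show ?case using IH \<open>m' \<le> 4 * A\<close> j' \<rho>' unfolding z_def
    by (intro exI[of _ "m(K := m')"] exI[of _ "j(K := j')"] exI[of _ \<rho>']) auto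
qed

text \<open>Multiplying slope and abscissa convolves their digits, and the factors \<open>1 / A\<close> and \<open>A * z\<close>
  multiply to \<open>z\<close>. So the ordinates are digit sums of the same form as the intercepts, with digits of size
  \<open>K * A\<^sup>2\<close> instead of \<open>A ^ 3\<close>: there are only about \<open>A ^ (2 K)\<close> of them. The digits of the
  product beyond place \<open>K\<close> contribute at most one unit of the last place.\<close>
lemma product_digits:
  fixes m n j :: "nat \<Rightarrow> nat"
  assumes A: "1 \<le> A" "4 * K\<^sup>2 \<le> A" and z: "z = 1 / real A ^ 3"
    and m: "\<forall>i. m i \<le> 4 * A" and n: "\<forall>i. n i \<le> A - 1" and j: "\<forall>i. j i \<le> A\<^sup>2"
  shows "\<exists>y\<in>digit_sums ((4 * K + 1) * A\<^sup>2) z z K.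
     y \<le> ((1 / real A) * (\<Sum>i<K. real (m i) * z ^ i)) * ((real A * z) * (\<Sum>i<K. real (n i) * z ^ i)) + z * (\<Sum>i<K. real (j i) * z ^ i) \<and>
     ((1 / real A) * (\<Sum>i<K. real (m i) * z ^ i)) * ((real A * z) * (\<Sum>i<K. real (n i) * z ^ i)) + z * (\<Sum>i<K. real (j i) * z ^ i) \<le> y + z ^ K"
proof -
  have z0: "0 < z" "z \<le> 1" using A(1) by (auto simp: z divide_le_eq)
  define e where "e t = (if t < K then j t + (\<Sum>i\<le>t. m i * n (t - i)) else 0)" for t
  have mn: "m i * n l \<le> 4 * A\<^sup>2" for i l
  proof -
    have "m i * n l \<le> (4 * A) * A" using m n by (intro mult_le_mono) (auto intro: le_trans)
    then show ?thesis by (simp add: power2_eq_square)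
  qed
  have e: "e t \<le> (4 * K + 1) * A\<^sup>2" for t
  proof (cases "t < K")
    case True
    have "(\<Sum>i\<le>t. m i * n (t - i)) \<le> (\<Sum>i\<le>t. 4 * A\<^sup>2)" by (intro sum_mono mn)
    also have "\<dots> = Suc t * (4 * A\<^sup>2)" by simp
    also have "\<dots> \<le> K * (4 * A\<^sup>2)" using True by (intro mult_le_mono1) simp
    finally show ?thesis using True j by (simp add: e_def algebra_simps add_mono)
  qed (simp add: e_def)
  define f where "f i l = real (m i) * real (n l) * z ^ (i + l)" for i l
  \<comment> \<open>the part of the product beyond place \<open>K\<close>\<close>
  define R where "R = (\<Sum>(i,l)\<in>{..<K}\<times>{..<K} - {(i,l). i + l < K}. f i l)"
  have sub: "{(i,l). i + l < K} \<subseteq> {..<K}\<times>{..<K}" by auto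
  have "(\<Sum>i<K. real (m i) * z ^ i) * (\<Sum>i<K. real (n i) * z ^ i) = (\<Sum>(i,l)\<in>{..<K}\<times>{..<K}. f i l)"
    unfolding sum_product sum.cartesian_product f_def by (simp add: power_add mult_ac)
  also have "\<dots> = R + (\<Sum>(i,l)\<in>{(i,l). i + l < K}. f i l)"
    unfolding R_def by (rule sum.subset_diff[OF sub]) simp
  also have "(\<Sum>(i,l)\<in>{(i,l). i + l < K}. f i l) = (\<Sum>t<K. \<Sum>i\<le>t. f i (t - i))"
    by (rule sum.triangle_reindex)
  also have "\<dots> = (\<Sum>t<K. (\<Sum>i\<le>t. real (m i) * real (n (t - i))) * z ^ t)"
    by (intro sum.cong refl) (simp add: f_def sum_distrib_right)
  finally have prod: "(\<Sum>i<K. real (m i) * z ^ i) * (\<Sum>i<K. real (n i) * z ^ i)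
     = R + (\<Sum>t<K. (\<Sum>i\<le>t. real (m i) * real (n (t - i))) * z ^ t)" .
  define y where "y = z * (\<Sum>t<K. real (e t) * z ^ t)"
  have e_sum: "(\<Sum>t<K. real (e t) * z ^ t)
      = (\<Sum>t<K. real (j t) * z ^ t) + (\<Sum>t<K. (\<Sum>i\<le>t. real (m i) * real (n (t - i))) * z ^ t)"
    unfolding sum.distrib[symmetric] by (intro sum.cong refl) (simp add: e_def algebra_simps)
  have eq: "((1 / real A) * (\<Sum>i<K. real (m i) * z ^ i)) * ((real A * z) * (\<Sum>i<K. real (n i) * z ^ i)) + z * (\<Sum>i<K. real (j i) * z ^ i)
      = y + z * R"
  proof -
    have cancel: "((1 / real A) * S) * ((real A * z) * T) = z * (S * T)" for S T using A(1) by simp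
    show ?thesis unfolding cancel prod y_def e_sum by (simp only: distrib_left add_ac)
  qed
  have "0 \<le> R" unfolding R_def f_def using z0 by (intro sum_nonneg) auto
  then have R0: "0 \<le> z * R" using z0 by simp
  have "R \<le> real (card ({..<K}\<times>{..<K} - {(i,l). i + l < K})) * (4 * real A ^ 2 * z ^ K)"
    unfolding R_def
  proof (rule sum_bounded_above)
    fix p assume p: "p \<in> {..<K}\<times>{..<K} - {(i,l). i + l < K}"
    obtain i l where il: "p = (i,l)" by fastforce
    have "real (m i * n l) \<le> real (4 * A\<^sup>2)" using mn of_nat_le_iff by blast
    then have "real (m i * n l) * z ^ (i + l) \<le> (4 * real A ^ 2) * z ^ K"
      using z0 p il by (intro mult_mono power_decreasing) auto
    then have "f i l \<le> (4 * real A ^ 2) * z ^ K" by (simp add: f_def)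
    then show "(case p of (i,l) \<Rightarrow> f i l) \<le> 4 * real A ^ 2 * z ^ K" by (simp add: il)
  qed
  also have "\<dots> \<le> real (K\<^sup>2) * (4 * real A ^ 2 * z ^ K)"
  proof -
    have "card ({..<K}\<times>{..<K} - {(i,l). i + l < K}) \<le> card ({..<K}\<times>{..<K})" by (intro card_mono) auto
    then have "card ({..<K}\<times>{..<K} - {(i,l). i + l < K}) \<le> K\<^sup>2" by (simp add: power2_eq_square)
    then show ?thesis using z0 by (intro mult_right_mono of_nat_mono) auto
  qed
  also have "\<dots> = real (4 * K\<^sup>2) * real A ^ 2 * z ^ K" by simp
  also have "\<dots> \<le> real A * real A ^ 2 * z ^ K"
    using A(2) z0 by (intro mult_right_mono of_nat_mono) auto
  finally have "z * R \<le> z * (real A * real A ^ 2 * z ^ K)" using z0 by (intro mult_left_mono) auto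
  also have "\<dots> = z ^ K" using A(1) by (simp add: z power3_eq_cube power2_eq_square)
  finally have R1: "z * R \<le> z ^ K" .
  have "y \<in> digit_sums ((4 * K + 1) * A\<^sup>2) z z K" unfolding digit_sums_def y_def using e by blast
  then show ?thesis unfolding eq using R0 R1 by (intro bexI[of _ y]) auto
qed

text \<open>The digit places of the abscissae are chosen such that their products with the digits of the
  slopes fall on places already used by the intercepts.\<close>
definition abscissae :: "nat \<Rightarrow> nat \<Rightarrow> real set" where
  "abscissae A = digit_sums (A - 1) (real A * (1 / real A ^ 3)) (1 / real A ^ 3)"

lemma abscissae_bounds:
  assumes "1 \<le> A" "p \<in> abscissae A l"
  shows "0 \<le> p" "p \<le> 1 / real A"
proof -
  define a where "a = real A"
  have a: "1 \<le> a" using assms(1) by (simp add: a_def)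
  have "0 \<le> p \<and> p \<le> 1 / a" using assms(2)
  proof (induction l arbitrary: p)
    case (Suc l)
    then obtain k q where *: "k \<le> A - 1" "q \<in> abscissae A l" "p = (a * (1 / a ^ 3)) * real k + (1 / a ^ 3) * q"
      by (auto simp: abscissae_def digit_sums_Suc a_def)
    have q: "0 \<le> q" "q \<le> 1 / a" using Suc.IH[OF *(2)] by auto
    have "1 / a \<le> 1" using a by simp
    then have "q \<le> a" using q(2) a by linarith
    have "real k \<le> a - 1" using *(1) assms(1) unfolding a_def by linarith
    then have "p \<le> (a * (1 / a ^ 3)) * (a - 1) + (1 / a ^ 3) * a"
      unfolding *(3) using a \<open>q \<le> a\<close> by (intro add_mono mult_left_mono) auto
    also have "\<dots> = 1 / a" using a by (simp add: field_simps power3_eq_cube)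
    finally show ?case using q a unfolding *(3) by auto
  qed (use a in \<open>simp add: abscissae_def\<close>)
  then show "0 \<le> p" "p \<le> 1 / real A" by (auto simp: a_def)
qed

lemma abscissae_separated:
  assumes A: "2 \<le> A"
  shows "p \<in> abscissae A l \<Longrightarrow> q \<in> abscissae A l \<Longrightarrow> p \<noteq> q \<Longrightarrow> (1 / real A ^ 3) ^ l \<le> \<bar>p - q\<bar>"
    and "card (abscissae A l) = A ^ l"
proof -
  define a where "a = real A"
  have a: "2 \<le> a" using A by (simp add: a_def)
  define z where "z = 1 / a ^ 3"
  have z: "0 < z" "z \<le> 1" using a by (auto simp: z_def)
  have far: "z \<le> \<bar>(a * z * real k + z * p) - (a * z * real k' + z * p')\<bar>"
    if "k \<noteq> k'" "p \<in> abscissae A l" "p' \<in> abscissae A l" for k k' p p' l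
  proof -
    have "0 \<le> p" "p \<le> 1" "0 \<le> p'" "p' \<le> 1"
      using abscissae_bounds[OF _ that(2)] abscissae_bounds[OF _ that(3)] A
      by (auto intro: order_trans)
    then have "\<bar>p - p'\<bar> \<le> 1" by auto
    moreover have "1 \<le> \<bar>real k - real k'\<bar>" using that(1) by linarith
    then have "2 * 1 \<le> a * \<bar>real k - real k'\<bar>" using a by (intro mult_mono) auto
    then have "2 \<le> \<bar>a * (real k - real k')\<bar>" using a by (simp add: abs_mult)
    ultimately have "1 \<le> \<bar>a * (real k - real k') + (p - p')\<bar>" by linarith
    then have "z * 1 \<le> z * \<bar>a * (real k - real k') + (p - p')\<bar>" using z by (intro mult_left_mono) auto
    also have "\<dots> = \<bar>z * (a * (real k - real k') + (p - p'))\<bar>" using z by (simp add: abs_mult)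
    finally show ?thesis by (simp add: algebra_simps)
  qed
  have Suc_eq: "abscissae A (Suc l) = (\<lambda>(k, p). a * z * real k + z * p) ` ({..A - 1} \<times> abscissae A l)" for l
    by (simp add: abscissae_def digit_sums_Suc a_def z_def)
  have sep: "\<forall>p\<in>abscissae A l. \<forall>q\<in>abscissae A l. p \<noteq> q \<longrightarrow> z ^ l \<le> \<bar>p - q\<bar>" for l
  proof (induction l)
    case (Suc l)
    show ?case
    proof (intro ballI impI)
      fix p q assume "p \<in> abscissae A (Suc l)" "q \<in> abscissae A (Suc l)" and ne: "p \<noteq> q"
      then obtain k k' p' q' where *: "p' \<in> abscissae A l" "q' \<in> abscissae A l"
        "p = a * z * real k + z * p'" "q = a * z * real k' + z * q'"
        unfolding Suc_eq by auto
      show "z ^ Suc l \<le> \<bar>p - q\<bar>"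
      proof (cases "k = k'")
        case True
        then have "p' \<noteq> q'" using ne * by auto
        then have "z * z ^ l \<le> z * \<bar>p' - q'\<bar>" using Suc * z by (intro mult_left_mono) auto
        also have "\<dots> = \<bar>p - q\<bar>" using True z unfolding * by (simp add: abs_mult flip: right_diff_distrib)
        finally show ?thesis by simp
      next
        case False
        have "z ^ Suc l \<le> z" using z by (simp add: mult_left_le power_le_one)
        then show ?thesis using far[OF False *(1,2)] unfolding * by linarith
      qed
    qed
  qed (simp add: abscissae_def)
  then show "p \<in> abscissae A l \<Longrightarrow> q \<in> abscissae A l \<Longrightarrow> p \<noteq> q \<Longrightarrow> (1 / real A ^ 3) ^ l \<le> \<bar>p - q\<bar>"
    by (simp add: z_def a_def)
  show "card (abscissae A l) = A ^ l"
  proof (induction l)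
    case (Suc l)
    have "inj_on (\<lambda>(k, p). a * z * real k + z * p) ({..A - 1} \<times> abscissae A l)"
    proof (rule inj_onI, clarify)
      fix k p k' p' assume *: "p \<in> abscissae A l" "p' \<in> abscissae A l"
        "a * z * real k + z * p = a * z * real k' + z * p'"
      then have "k = k'" using far[of k k' p l p'] z by force
      then show "k = k' \<and> p = p'" using * z by auto
    qed
    then show ?case unfolding Suc_eq using Suc A by (simp add: card_image card_cartesian_product)
  qed (simp add: abscissae_def)
qed

text \<open>The extremal configuration. With \<open>\<rho>\<close> the mesh, the grid \<open>X \<times> Y\<close> has about \<open>A ^ (3 K)\<close>
  points, and through every point of a fixed rectangle there is, up to \<open>\<rho>\<close>, a line of admissible slope that
  passes close to a grid point above each of the \<open>A ^ K\<close> abscissae. This is the sharp case of the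
  Szemeredi-Trotter bound: about \<open>N\<close> points and \<open>N\<close> lines with about \<open>N powr (4/3)\<close> incidences. The
  dilation by \<open>\<eta>\<close> acts on slopes and ordinates and leaves the abscissae alone.\<close>
lemma nikodym_op_norm_cantor:
  fixes A K :: nat and \<eta> q :: real
  assumes A: "4 \<le> A" "4 * K\<^sup>2 \<le> A" and K: "1 \<le> K" and \<eta>: "0 < \<eta>" "\<eta> \<le> 1/10"
    and \<Theta>: "\<And>p. p \<in> cantor_slopes A K \<Longrightarrow> slope_dir (\<eta> * p) \<in> \<Theta>"
    and \<rho>: "\<rho> = \<eta> * (1 / real A ^ 3) ^ K" and q: "1 \<le> q"
  shows "ennreal (real A ^ K * \<rho> / 144 * (3/20 / ((6 * real K) ^ K * \<rho>)) powr (1/q))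
         \<le> Lq_op_norm q (nikodym \<Theta> (8 * \<rho>))"
proof -
  define z where "z = 1 / real A ^ 3"
  have z: "0 < z" "z \<le> 1" using A by (auto simp: z_def divide_le_eq)
  have zK: "0 < z ^ K" "z ^ K \<le> 1" using z by (auto simp: power_le_one)
  have \<rho>z: "\<rho> = \<eta> * z ^ K" by (simp add: \<rho> z_def)
  have \<rho>0: "0 < \<rho>" "\<rho> < z ^ K" "\<rho> \<le> \<eta>" using \<eta> zK mult_left_le[of "z ^ K" \<eta>]
    by (auto simp: \<rho>z)
  note sq_measure = square_lebesgue(2)[OF less_imp_le[OF \<rho>0(1)]]
  define X where "X = abscissae A K"
  define Y where "Y = digit_sums ((4 * K + 1) * A\<^sup>2) z z K"
  define E where "E = (\<Union>(x,y)\<in>X \<times> Y. square \<rho> x (\<eta> * y))"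
  \<comment> \<open>\<open>x \<ge> 1/4\<close> is needed for greedy expansions; \<open>x \<le> 2/5\<close> lets the tubes centred at \<open>x\<close> reach all of \<open>X\<close>\<close>
  define F where "F = {p::real^2. 1/4 \<le> p$1 \<and> p$1 \<le> 2/5 \<and> 0 \<le> p$2 \<and> p$2 \<le> \<eta>}"
  have finX: "finite X" and finY: "finite Y" by (simp_all add: X_def Y_def abscissae_def)
  have cardX: "card X = A ^ K" using abscissae_separated(2)[of A K] A by (simp add: X_def)
  have cardY: "real (card Y) \<le> (6 * real K * real A ^ 2) ^ K"
  proof -
    have "card Y \<le> ((4 * K + 1) * A\<^sup>2 + 1) ^ K" unfolding Y_def by (rule card_digit_sums)
    also have "\<dots> \<le> (6 * K * A\<^sup>2) ^ K"
    proof (rule power_mono)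
      have "1 * 1 \<le> K * A\<^sup>2" using K A by (intro mult_le_mono) auto
      moreover have "1 * A\<^sup>2 \<le> K * A\<^sup>2" using K by (intro mult_le_mono1) auto
      ultimately have "4 * (K * A\<^sup>2) + A\<^sup>2 + 1 \<le> 6 * (K * A\<^sup>2)" by linarith
      then show "(4 * K + 1) * A\<^sup>2 + 1 \<le> 6 * K * A\<^sup>2" by (simp add: algebra_simps)
    qed simp
    finally show ?thesis by (metis of_nat_le_iff of_nat_power of_nat_mult of_nat_numeral)
  qed
  have Esets: "E \<in> sets lebesgue" unfolding E_def using finX finY \<rho>0
    by (intro sets.finite_UN) (auto intro: square_lebesgue)
  define M where "M = (6 * real K) ^ K * \<rho> * \<eta>"
  have M0: "0 < M" using K \<rho>0 \<eta> by (simp add: M_def)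
  have EM: "emeasure lebesgue E \<le> ennreal M"
  proof -
    have "emeasure lebesgue E \<le> (\<Sum>(x,y)\<in>X \<times> Y. emeasure lebesgue (square \<rho> x (\<eta> * y)))"
      unfolding E_def case_prod_beta using finX finY \<rho>0
      by (intro emeasure_subadditive_finite) (auto intro: square_lebesgue)
    also have "\<dots> = ennreal (real (card X * card Y) * \<rho>\<^sup>2)"
      unfolding case_prod_beta sq_measure
      by (simp add: card_cartesian_product ennreal_mult' ennreal_of_nat_eq_real_of_nat)
    also have "\<dots> \<le> ennreal M"
    proof (rule ennreal_leI)
      have "real (card X * card Y) * \<rho>\<^sup>2 \<le> (real A ^ K * (6 * real K * real A ^ 2) ^ K) * \<rho>\<^sup>2"
        using cardY by (intro mult_right_mono) (auto simp: cardX intro!: mult_left_mono)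
      also have "real A ^ K * (6 * real K * real A ^ 2) ^ K = (6 * real K) ^ K * (real A ^ 3) ^ K"
        by (simp add: power_mult_distrib power3_eq_cube power2_eq_square)
      also have "(6 * real K) ^ K * (real A ^ 3) ^ K * \<rho>\<^sup>2 = M"
        using A by (simp add: M_def \<rho> power2_eq_square power_one_over)
      finally show "real (card X * card Y) * \<rho>\<^sup>2 \<le> M" .
    qed
    finally show ?thesis .
  qed
  have F: "emeasure lebesgue F = ennreal (3/20 * \<eta>)" "F \<in> sets lebesgue"
    unfolding F_def using emeasure_cbox_2[of "1/4" "2/5" 0 \<eta>] \<eta> by (auto simp: field_simps)
  \<comment> \<open>\<open>144 * \<rho>\<close> is the bound \<open>18 * (8 * \<rho>)\<close> for the area of a tube, and \<open>3/20\<close> the width of \<open>F\<close>\<close>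
  have "ennreal ((real A ^ K * \<rho>\<^sup>2) / (144 * \<rho>) * ((3/20 * \<eta>) / M) powr (1/q))
        \<le> Lq_op_norm q (nikodym \<Theta> (8 * \<rho>))"
  proof (rule nikodym_op_norm_ge[OF q Esets F(2) EM M0 F(1)])
    fix p assume p: "p \<in> F"
    define x where "x = p$1"
    define v where "v = p$2 / \<eta>"
    have x: "1/4 \<le> x" "x \<le> 2/5" and v: "0 \<le> v" "v \<le> 1" and p2: "p$2 = \<eta> * v"
      using p \<eta> by (auto simp: F_def x_def v_def)
    have p_eq: "p = vector [x, \<eta> * v]" by (simp add: vec_eq_iff forall_2 x_def p2)
    obtain m j r where mj: "\<forall>i. m i \<le> 4 * A" "\<forall>i. j i \<le> A\<^sup>2" and r: "0 \<le> r" "r \<le> 1"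
      and v_eq: "v = (\<Sum>i<K. (real (m i) * x / real A + real (j i) * z) * z ^ i) + z ^ K * r"
      using greedy_expansion[of A x v K] A x v unfolding z_def by auto
    define \<theta> where "\<theta> = (1 / real A) * (\<Sum>i<K. real (m i) * z ^ i)"
    define b where "b = z * (\<Sum>i<K. real (j i) * z ^ i)"
    \<comment> \<open>the point \<open>p\<close> lies within \<open>\<rho>\<close> above the line of slope \<open>s = \<eta> * \<theta>\<close> and intercept \<open>\<eta> * b\<close>\<close>
    have v_line: "v = \<theta> * x + b + z ^ K * r"
      unfolding v_eq \<theta>_def b_def
      by (simp add: sum.distrib sum_distrib_left sum_distrib_right algebra_simps)
    have \<theta>: "\<theta> \<in> cantor_slopes A K" unfolding cantor_slopes_def digit_sums_def \<theta>_def z_def using mj(1) by blast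
    have \<theta>b: "0 \<le> \<theta>" "\<theta> \<le> 5" using cantor_slopes_bounds[OF _ \<theta>] A by auto
    define s where "s = \<eta> * \<theta>"
    have "s \<le> 1/10 * 5" unfolding s_def using \<eta> \<theta>b by (intro mult_mono) auto
    then have s: "\<bar>s\<bar> \<le> 1/2" using \<eta> \<theta>b by (simp add: s_def)
    have "\<exists>y\<in>Y. y \<le> \<theta> * x' + b \<and> \<theta> * x' + b \<le> y + z ^ K" if x': "x' \<in> X" for x'
    proof -
      obtain n where n: "\<forall>i. n i \<le> A - 1" "x' = (real A * z) * (\<Sum>i<K. real (n i) * z ^ i)"
        using x' unfolding X_def abscissae_def digit_sums_def z_def by blast
      show ?thesis unfolding Y_def n(2) \<theta>_def b_def
        by (rule product_digits[OF _ A(2) z_def mj(1) n(1) mj(2)]) (use A in simp)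
    qed
    \<comment> \<open>for each abscissa, the ordinate of the grid point just below that line\<close>
    then obtain Yf where Yf: "\<And>x'. x' \<in> X \<Longrightarrow> Yf x' \<in> Y"
      "\<And>x'. x' \<in> X \<Longrightarrow> Yf x' \<le> \<theta> * x' + b" "\<And>x'. x' \<in> X \<Longrightarrow> \<theta> * x' + b \<le> Yf x' + z ^ K"
      by metis
    define T where "T = tube (8 * \<rho>) p (slope_dir s)"
    have Tsets: "T \<in> sets lebesgue"
      unfolding T_def using closed_tube by (metis borel_closed sets_completionI_sets sets_lborel)
    have sq: "square \<rho> x' (\<eta> * Yf x') \<subseteq> E \<inter> T" if x': "x' \<in> X" for x'
    proof
      fix w assume w: "w \<in> square \<rho> x' (\<eta> * Yf x')"
      have "w \<in> E" using w x' Yf(1) unfolding E_def by auto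
      have "1 / real A \<le> 1/4" using A by (simp add: divide_simps)
      moreover have "0 \<le> x'" "x' \<le> 1 / real A"
        using abscissae_bounds[of A x' K] x' A unfolding X_def by auto
      ultimately have x'b: "0 \<le> x'" "x' \<le> 1/4" by linarith+
      have "\<eta> * Yf x' \<le> \<eta> * (\<theta> * x' + b)" "\<eta> * (\<theta> * x' + b) \<le> \<eta> * (Yf x' + z ^ K)"
        using Yf(2,3)[OF x'] \<eta> by (auto intro: mult_left_mono)
      moreover have "\<eta> * (Yf x' + z ^ K) = \<eta> * Yf x' + \<rho>" by (simp add: \<rho>z distrib_left)
      moreover have "\<eta> * v + s * (x' - x) = \<eta> * (\<theta> * x' + b) + \<rho> * r"
        by (simp add: v_line s_def \<rho>z algebra_simps)
      moreover have "0 \<le> \<rho> * r" "\<rho> * r \<le> \<rho>" using r \<rho>0 by (auto simp: mult_left_le)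
      moreover have "\<eta> * Yf x' \<le> w$2" "w$2 \<le> \<eta> * Yf x' + \<rho>" using w by (auto simp: square_def)
      ultimately have "\<bar>w$2 - (\<eta> * v + s * (x' - x))\<bar> \<le> 3 * \<rho>"
        using \<rho>0 by linarith
      moreover have "\<bar>w$1 - x'\<bar> \<le> \<rho>" using w by (auto simp: square_def)
      moreover have "\<bar>x - x'\<bar> \<le> 2/5" using x x'b by auto
      ultimately have "w \<in> T" unfolding T_def p_eq by (intro square_in_tube s)
      then show "w \<in> E \<inter> T" using \<open>w \<in> E\<close> by blast
    qed
    have disj: "disjoint_family_on (\<lambda>x'. square \<rho> x' (\<eta> * Yf x')) X"
    proof (unfold disjoint_family_on_def, intro ballI impI)
      fix x1 x2 assume *: "x1 \<in> X" "x2 \<in> X" "x1 \<noteq> x2"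
      have "z ^ K \<le> \<bar>x1 - x2\<bar>"
        using abscissae_separated(1)[of A x1 K x2] * A unfolding X_def z_def by simp
      then have far: "\<rho> < \<bar>x1 - x2\<bar>" using \<rho>0 by linarith
      then show "square \<rho> x1 (\<eta> * Yf x1) \<inter> square \<rho> x2 (\<eta> * Yf x2) = {}"
        by (auto simp: square_def)
    qed
    have "ennreal (real A ^ K * \<rho>\<^sup>2) = (\<Sum>x'\<in>X. emeasure lebesgue (square \<rho> x' (\<eta> * Yf x')))"
      unfolding sq_measure
      by (simp add: cardX ennreal_mult' ennreal_of_nat_eq_real_of_nat flip: of_nat_power)
    also have "\<dots> = emeasure lebesgue (\<Union>x'\<in>X. square \<rho> x' (\<eta> * Yf x'))"
      using disj finX \<rho>0 by (intro sum_emeasure) (auto intro: square_lebesgue)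
    also have "\<dots> \<le> emeasure lebesgue (E \<inter> T)"
      using sq Esets Tsets by (intro emeasure_mono) auto
    finally have "ennreal (real A ^ K * \<rho>\<^sup>2) \<le> emeasure lebesgue (E \<inter> T)" .
    moreover have "emeasure lebesgue T \<le> ennreal (144 * \<rho>)"
      using emeasure_tube_le[of "slope_dir s" "8 * \<rho>" p] \<rho>0 \<eta> norm_slope_dir by (simp add: T_def)
    ultimately show "\<exists>w\<in>\<Theta>. ennreal (real A ^ K * \<rho>\<^sup>2) \<le> emeasure lebesgue (E \<inter> tube (8 * \<rho>) p w) \<and>
                     emeasure lebesgue (tube (8 * \<rho>) p w) \<le> ennreal (144 * \<rho>)"
      unfolding T_def s_def using \<Theta>[OF \<theta>] by blast
  qed (use \<eta> \<rho>0 in auto)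
  moreover have "(real A ^ K * \<rho>\<^sup>2) / (144 * \<rho>) = real A ^ K * \<rho> / 144"
    using \<rho>0 by (simp add: power2_eq_square)
  moreover have "(3/20 * \<eta>) / M = 3/20 / ((6 * real K) ^ K * \<rho>)" using \<eta> by (simp add: M_def)
  ultimately show ?thesis by simp
qed


section \<open>Choice of the scales\<close>

definition scale_count :: "nat \<Rightarrow> nat" where "scale_count n = (Suc n)\<^sup>2"

text \<open>Write \<open>A\<close> for this base and \<open>K\<close> for \<open>scale_count n\<close>. The losses \<open>(6 K) ^ K\<close> from the grid and \<open>5 ^ K\<close> from the
  covering must be bounded by \<open>A\<close>. The dilation \<open>A ^ -N\<close> with \<open>N = Suc n\<close> must beat every fixed power of \<open>A\<close> as
  \<open>n\<close> grows. Yet it must be a small power of the mesh \<open>A ^ (-N - 3 K)\<close>, which is why \<open>K = N\<^sup>2\<close>. The number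
  \<open>4000\<close> exceeds the product \<open>4 * 144 * 20/3\<close> of the constants that accumulate in
  \<open>scale_exponent_bound\<close>.\<close>
definition scale_base :: "nat \<Rightarrow> nat" where "scale_base n = (4000 * scale_count n) ^ scale_count n"

definition dilation :: "nat \<Rightarrow> real" where "dilation n = 1 / real (scale_base n) ^ Suc n"

definition mesh :: "nat \<Rightarrow> real" where
  "mesh n = dilation n * (1 / real (scale_base n) ^ 3) ^ scale_count n"

lemma scale_count_ge: "Suc n \<le> scale_count n"
  by (simp add: scale_count_def power2_eq_square)

lemma scale_base_ge:
  "(6 * scale_count n) ^ scale_count n \<le> scale_base n" "4000 \<le> scale_base n"
  "4 * (scale_count n)\<^sup>2 \<le> scale_base n" "5 ^ scale_count n \<le> scale_base n" "2 ^ n \<le> scale_base n"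
proof -
  define K where "K = scale_count n"
  have K: "1 \<le> K" "n \<le> K" using scale_count_ge[of n] by (simp_all add: K_def)
  have pow: "c ^ K \<le> scale_base n" if "c \<le> 4000" for c
  proof -
    have "c ^ K \<le> (4000 * K) ^ K"
      using that K(1) by (intro power_mono) (auto intro: le_trans)
    then show ?thesis by (simp add: scale_base_def K_def)
  qed
  show "(6 * scale_count n) ^ scale_count n \<le> scale_base n"
    unfolding scale_base_def by (intro power_mono) auto
  show "5 ^ scale_count n \<le> scale_base n" using pow[of 5] by (simp add: K_def)
  have "(4000::nat) ^ 1 \<le> 4000 ^ K" using K by (intro power_increasing) auto
  then show "4000 \<le> scale_base n" using pow[of 4000] by simp
  have "(2::nat) ^ n \<le> 2 ^ K" using K by (intro power_increasing) auto
  also have "2 ^ K \<le> scale_base n" by (rule pow) simp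
  finally show "2 ^ n \<le> scale_base n" .
  have "K \<le> 2 ^ K" using less_exp[of K] by simp
  then have "K\<^sup>2 \<le> (2 ^ K)\<^sup>2" by (intro power_mono) auto
  moreover have "(4::nat) ^ 1 \<le> 4 ^ K" using K by (intro power_increasing) auto
  ultimately have "4 * K\<^sup>2 \<le> 4 ^ K * (2 ^ K)\<^sup>2" by (intro mult_mono) auto
  also have "\<dots> = 16 ^ K" by (simp add: power2_eq_square flip: power_mult_distrib)
  also have "\<dots> \<le> scale_base n" by (rule pow) simp
  finally show "4 * (scale_count n)\<^sup>2 \<le> scale_base n" by (simp add: K_def)
qed

lemma dilation_bounds: "0 < dilation n" "dilation n \<le> 1 / real (scale_base n)" "dilation n \<le> 1 / 4000"
proof -
  have A: "4000 \<le> real (scale_base n)" using scale_base_ge(2)[of n] by linarith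
  then show "0 < dilation n" by (simp add: dilation_def)
  have "real (scale_base n) ^ 1 \<le> real (scale_base n) ^ Suc n" using A by (intro power_increasing) auto
  then show 1: "dilation n \<le> 1 / real (scale_base n)"
    unfolding dilation_def using A by (intro divide_left_mono) auto
  have "1 / real (scale_base n) \<le> 1 / 4000" using A by (intro divide_left_mono) auto
  then show "dilation n \<le> 1 / 4000" using 1 by linarith
qed

text \<open>The terms are at most \<open>A ^ 3 * A powr (- N * \<tau>)\<close>, hence at most \<open>1 / A \<le> (1/2) ^ n\<close> once
  \<open>N * \<tau> \<ge> 4\<close>.\<close>
lemma summable_scale_losses:
  assumes "0 < \<tau>"
  shows "summable (\<lambda>n. 5 ^ scale_count n * real (scale_base n) ^ 2 * dilation n powr \<tau>)"
proof (rule summable_comparison_test_ev)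
  show "summable (\<lambda>n. (1/2::real) ^ n)" by (simp add: summable_geometric)
  have "eventually (\<lambda>n. 4 / \<tau> \<le> real n) sequentially"
    using eventually_ge_at_top[of "nat \<lceil>4 / \<tau>\<rceil>"] by eventually_elim linarith
  then show "eventually (\<lambda>n. norm (5 ^ scale_count n * real (scale_base n) ^ 2 * dilation n powr \<tau>) \<le> (1/2) ^ n) sequentially"
  proof eventually_elim
    case (elim n)
    define a where "a = real (scale_base n)"
    have a: "4000 \<le> a" "5 ^ scale_count n \<le> a" "2 ^ n \<le> a"
      using scale_base_ge(2,4,5)[of n] unfolding a_def
      by (metis of_nat_le_iff of_nat_numeral of_nat_power)+
    have "dilation n = a powr (- real (Suc n))"
      using a by (simp add: dilation_def a_def[symmetric] powr_minus_divide powr_realpow del: power_Suc of_nat_Suc)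
    then have "dilation n powr \<tau> = a powr (- (real (Suc n) * \<tau>))"
      by (simp only: powr_powr mult_minus_left)
    also have "\<dots> \<le> a powr (- 4)"
    proof (rule powr_mono)
      have "4 \<le> real n * \<tau>" using elim assms by (simp add: field_simps)
      then show "- (real (Suc n) * \<tau>) \<le> - 4" using assms by (simp add: algebra_simps)
    qed (use a in auto)
    finally have "5 ^ scale_count n * a ^ 2 * dilation n powr \<tau> \<le> a * a ^ 2 * a powr (- 4)"
      using a by (intro mult_mono) auto
    also have "a powr (- 4) = 1 / a ^ 4" using a by (simp add: powr_minus_divide)
    also have "a * a ^ 2 * (1 / a ^ 4) = 1 / a" using a by (simp add: power2_eq_square power4_eq_xxxx)
    also have "\<dots> \<le> 1 / 2 ^ n" using a by (intro divide_left_mono) auto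
    finally show ?case by (simp add: a_def power_one_over)
  qed
qed

lemma mesh_bounds: "0 < mesh n" "mesh n \<le> (1/2) ^ n" "mesh n \<le> 1 / 4000"
proof -
  define a where "a = real (scale_base n)"
  have a: "4000 \<le> a" "2 ^ n \<le> a"
    using scale_base_ge(2,5)[of n] unfolding a_def by (metis of_nat_le_iff of_nat_numeral of_nat_power)+
  show "0 < mesh n" using dilation_bounds[of n] a by (simp add: mesh_def a_def)
  have "(1 / a ^ 3) ^ scale_count n \<le> 1" using a by (intro power_le_one) (auto simp: divide_le_eq)
  then have 1: "mesh n \<le> dilation n"
    unfolding mesh_def a_def[symmetric] using dilation_bounds(1)[of n] by (simp add: mult_left_le)
  then show "mesh n \<le> 1 / 4000" using dilation_bounds(3)[of n] by linarith
  have "1 / a \<le> 1 / 2 ^ n" using a by (intro divide_left_mono) auto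
  then show "mesh n \<le> (1/2) ^ n" using 1 dilation_bounds(2)[of n] by (simp add: a_def power_one_over)
qed

text \<open>Since \<open>mesh n powr (1/3)\<close> equals \<open>dilation n powr (1/3) / A ^ K\<close>, the right-hand side is
  \<open>mesh n powr (2/3 - 1/q)\<close> up to the losses \<open>dilation n powr (1/3)\<close> and \<open>(6 K) ^ K\<close>, which together are at
  least about \<open>A ^ (-N - 1)\<close>. On the left, \<open>K = N\<^sup>2\<close> gives \<open>(8 * mesh n) powr (1/N) \<le> A ^ (-3 N)\<close>, which
  absorbs them.\<close>
lemma scale_exponent_bound:
  assumes q: "1 \<le> q"
  shows "(8 * mesh n) powr (2/3 - 1/q + 1 / real (Suc n))
     \<le> real (scale_base n) ^ scale_count n * mesh n / 144
         * (3/20 / ((6 * real (scale_count n)) ^ scale_count n * mesh n)) powr (1/q)"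
proof -
  define N K where "N = Suc n" and "K = scale_count n"
  define a where "a = real (scale_base n)"
  define \<eta> \<rho> where "\<eta> = dilation n" and "\<rho> = mesh n"
  define c where "c = 1/q"
  define B where "B = (6 * real K) ^ K"
  have c: "0 \<le> c" "c \<le> 1" using q by (simp_all add: c_def)
  have a: "4000 \<le> a" using scale_base_ge(2)[of n] unfolding a_def by linarith
  have "real ((6 * K) ^ K) \<le> a" using scale_base_ge(1)[of n] unfolding a_def K_def of_nat_le_iff .
  then have Ba: "B \<le> a" by (simp add: B_def)
  have "1 \<le> K" using scale_count_ge[of n] by (simp add: K_def)
  then have B1: "1 \<le> B" unfolding B_def by (intro one_le_power) auto
  have \<eta>: "\<eta> = 1 / a ^ N" by (simp add: \<eta>_def dilation_def a_def N_def)
  have \<eta>0: "0 < \<eta>" "\<eta> \<le> 1" "8 * \<eta> \<le> 1" using dilation_bounds(1,3)[of n] by (auto simp: \<eta>_def)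
  have \<rho>: "\<rho> = \<eta> * (1 / a ^ 3) ^ K" by (simp add: \<rho>_def mesh_def \<eta>_def a_def K_def)
  have \<rho>0: "0 < \<rho>" "8 * \<rho> < 1" using mesh_bounds[of n] by (auto simp: \<rho>_def)
  have eps: "(8 * \<rho>) powr (1 / real N) \<le> 1 / a ^ (3 * N)"
  proof -
    have "8 * \<rho> \<le> 1 * (1 / a ^ 3) ^ K" unfolding \<rho> mult.assoc[symmetric] using \<eta>0 a by (intro mult_right_mono) auto
    also have "\<dots> = (1 / a ^ (3 * N)) ^ N"
    proof -
      have "K = N * N" by (simp add: K_def scale_count_def N_def power2_eq_square)
      then show ?thesis by (simp only: power_one_over power_mult[symmetric] mult.assoc mult_1)
    qed
    finally have "(8 * \<rho>) powr (1 / real N) \<le> ((1 / a ^ (3 * N)) ^ N) powr (1 / real N)"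
      using \<rho>0 by (intro powr_mono2) auto
    also have "\<dots> = 1 / a ^ (3 * N)"
      using a by (subst powr_realpow[symmetric]) (auto simp: powr_powr N_def)
    finally show ?thesis .
  qed
  have "(8 * \<rho>) powr (2/3 - c) \<le> 4 * \<rho> powr (2/3 - c)"
  proof -
    have "8 powr (2/3 - c) \<le> 8 powr (2/3::real)" using c by (intro powr_mono) auto
    also have "8 powr (2/3::real) = (2 powr 3) powr (2/3::real)" by simp
    also have "\<dots> = 4" unfolding powr_powr by simp
    finally show ?thesis using \<rho>0 by (simp add: powr_mult mult_right_mono)
  qed
  then have "(8 * \<rho>) powr (2/3 - c) * (8 * \<rho>) powr (1 / real N) \<le> (4 * \<rho> powr (2/3 - c)) * (1 / a ^ (3 * N))"
    using eps by (intro mult_mono) auto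
  then have "(8 * \<rho>) powr (2/3 - c + 1 / real N) \<le> \<rho> powr (2/3 - c) * (4 / a ^ (3 * N))"
    by (simp add: powr_add mult_ac)
  \<comment> \<open>\<open>960\<close> is \<open>144\<close> divided by \<open>3/20\<close>\<close>
  also have "4 / a ^ (3 * N) \<le> \<eta> / (960 * B)"
  proof -
    have "3840 * B \<le> a * a" using a Ba B1 by (intro mult_mono) auto
    also have "\<dots> \<le> a ^ (2 * N)"
      using power_increasing[of 2 "2 * N" a] a by (simp add: N_def power2_eq_square)
    finally have "3840 * B * a ^ N \<le> a ^ (3 * N)"
      using a mult_right_mono[of "3840 * B" "a ^ (2 * N)" "a ^ N"] by (simp flip: power_add)
    then show ?thesis using a B1 unfolding \<eta> by (simp add: field_simps)
  qed
  also have "\<eta> / (960 * B) \<le> \<eta> powr (1/3) / 144 * (3/20 / B) powr c"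
  proof -
    have "\<eta> powr 1 \<le> \<eta> powr (1/3)" using \<eta>0 by (intro powr_mono') auto
    moreover have "(3/20 / B) powr 1 \<le> (3/20 / B) powr c"
      using c B1 by (intro powr_mono') (auto simp: divide_le_eq)
    ultimately have "\<eta> / 144 * (3/20 / B) \<le> \<eta> powr (1/3) / 144 * (3/20 / B) powr c"
      using \<eta>0 B1 by (intro mult_mono) auto
    then show ?thesis by (simp add: mult.commute)
  qed
  also have "\<rho> powr (2/3 - c) * (\<eta> powr (1/3) / 144 * (3/20 / B) powr c)
     = a ^ K * \<rho> / 144 * (3/20 / (B * \<rho>)) powr c"
  proof -
    have "(1 / a ^ 3) ^ K = (1 / a ^ K) ^ 3"
      by (simp add: power_one_over mult.commute flip: power_mult)
    also have "\<dots> = (1 / a ^ K) powr 3" using a by simp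
    finally have "\<rho> powr (1/3) = \<eta> powr (1/3) * ((1 / a ^ K) powr 3) powr (1/3)"
      unfolding \<rho> by (simp only: powr_mult)
    also have "((1 / a ^ K) powr 3) powr (1/3) = 1 / a ^ K" unfolding powr_powr using a by simp
    finally have e3: "\<eta> powr (1/3) = \<rho> powr (1/3) * a ^ K" using a by simp
    have "\<rho> powr (2/3 - c) * \<rho> powr (1/3) = \<rho> powr (1 - c)" by (simp flip: powr_add)
    also have "\<dots> = \<rho> / \<rho> powr c" using \<rho>0 by (simp add: powr_diff)
    finally have "\<rho> powr (2/3 - c) * \<rho> powr (1/3) = \<rho> / \<rho> powr c" .
    moreover have "(3/20 / (B * \<rho>)) powr c = (3/20 / B) powr c / \<rho> powr c"
      using B1 \<rho>0 by (simp add: mult.assoc flip: powr_divide)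
    moreover have "\<rho> powr (2/3 - c) * (\<eta> powr (1/3) / 144 * (3/20 / B) powr c)
      = (\<rho> powr (2/3 - c) * \<rho> powr (1/3)) * a ^ K / 144 * (3/20 / B) powr c"
      unfolding e3 by simp
    ultimately show ?thesis by (simp add: mult_ac)
  qed
  finally show ?thesis
    using \<rho>0 by (simp add: \<rho>_def c_def N_def a_def K_def B_def mult_left_mono)
qed


section \<open>The lower bound\<close>

theorem proposition3p8:
  shows "\<exists>(\<Theta> :: (real ^ 2) set) (\<delta> :: nat \<Rightarrow> real) (\<epsilon> :: nat \<Rightarrow> real).
           \<Theta> \<subseteq> sphere 0 1 \<and> qA_dim \<Theta> \<le> 1/3 \<and>
           (\<forall>n. 0 < \<delta> n \<and> \<delta> n < 1) \<and> (\<forall>n. 0 < \<epsilon> n) \<and>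
           \<delta> \<longlonglongrightarrow> 0 \<and> \<epsilon> \<longlonglongrightarrow> 0 \<and>
           (\<forall>n. \<forall>q::real. 1 \<le> q \<longrightarrow>
              ennreal (\<delta> n powr (2/3 - 1/q + \<epsilon> n)) \<le> Lq_op_norm q (nikodym \<Theta> (\<delta> n)))"
proof -
  define \<Theta> where "\<Theta> = slope_dir ` union_slopes scale_base scale_count dilation"
  have base: "4 \<le> scale_base n" for n using scale_base_ge(2)[of n] by linarith
  have "\<Theta> \<subseteq> sphere 0 1" by (auto simp: \<Theta>_def norm_slope_dir)
  moreover have "qA_dim \<Theta> \<le> 1/3"
    unfolding \<Theta>_def
  proof (rule qA_dim_union_slopes[OF base dilation_bounds(1) _ summable_scale_losses])
    show "5 * dilation n \<le> 1" for n using dilation_bounds(3)[of n] by simp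
  qed
  moreover have "0 < 8 * mesh n \<and> 8 * mesh n < 1" for n using mesh_bounds[of n] by auto
  moreover have "(\<lambda>n. 8 * mesh n) \<longlonglongrightarrow> 0"
  proof (rule tendsto_sandwich[OF _ _ tendsto_const])
    show "eventually (\<lambda>n. 0 \<le> 8 * mesh n) sequentially"
      using mesh_bounds(1) by (simp add: less_imp_le)
    show "eventually (\<lambda>n. 8 * mesh n \<le> 8 * (1/2) ^ n) sequentially"
      using mesh_bounds(2) by simp
    show "(\<lambda>n. 8 * (1/2::real) ^ n) \<longlonglongrightarrow> 0"
      using tendsto_mult_left[OF LIMSEQ_power_zero[of "1/2::real"], of 8] by simp
  qed
  moreover have "(\<lambda>n. 1 / real (Suc n)) \<longlonglongrightarrow> 0" using LIMSEQ_Suc[OF lim_1_over_n] .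
  moreover have "ennreal ((8 * mesh n) powr (2/3 - 1/q + 1 / real (Suc n))) \<le> Lq_op_norm q (nikodym \<Theta> (8 * mesh n))"
    if q: "1 \<le> q" for n and q :: real
  proof -
    have "ennreal (real (scale_base n) ^ scale_count n * mesh n / 144
           * (3/20 / ((6 * real (scale_count n)) ^ scale_count n * mesh n)) powr (1/q))
        \<le> Lq_op_norm q (nikodym \<Theta> (8 * mesh n))"
    proof (rule nikodym_op_norm_cantor[OF base scale_base_ge(3) _ dilation_bounds(1) _ _ mesh_def q])
      show "1 \<le> scale_count n" using scale_count_ge[of n] by simp
      show "dilation n \<le> 1/10" using dilation_bounds(3)[of n] by simp
      show "slope_dir (dilation n * p) \<in> \<Theta>" if "p \<in> cantor_slopes (scale_base n) (scale_count n)" for p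
        using that by (auto simp: \<Theta>_def union_slopes_def)
    qed
    then show ?thesis using ennreal_leI[OF scale_exponent_bound[OF q]] order_trans by blast
  qed
  moreover have "0 < 1 / real (Suc n)" for n by simp
  ultimately show ?thesis
    by (intro exI[of _ \<Theta>] exI[of _ "\<lambda>n. 8 * mesh n"] exI[of _ "\<lambda>n. 1 / real (Suc n)"]) blast
qed

end
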